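(* Let $\Sigma_A$ be an irreducible subshift of finite type on the alphabet $\mathcal{J}=\{0,1,\dots,M-1\}$, with associated contracting similarities $S_i(x)=r_iT_i(x)+v_i$ ($i\in\mathcal{J}$) of $\mathbb{R}^d$, such that at least one $F_A^i$ ($i\in\mathcal{J}$) contains at least two points, let $j\in\mathcal{J}$ and assume that $\mathcal{T}_{j,A}^G$ is a finite group. Then for every $\varepsilon>0$ and every $O\in\mathcal{T}_{j,A}^G$ there exist $r\in(0,1)$ and a self-similar iterated function system (SS-IFS) $\{\widetilde S_i\}_{i=1}^m$, $\widetilde S_i(x)=\widetilde r_i\widetilde T_i(x)+\widetilde v_i$, in $\mathbb{R}^d$ that satisfies the strong separation condition, with attractor $K$, such that $K\subseteq F_A^j\subseteq F_A$, $\dim_H F_A-\varepsilon<\dim_H K$, and $\widetilde T_i=O$ and $\widetilde r_i=r$ for every $i\in\{1,\dots,m\}$.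
   Context: Subshifts of finite type. Let $\mathcal{J}=\{0,1,\dots,M-1\}$ and let $A$ be an $M\times M$ matrix indexed by $\mathcal{J}\times\mathcal{J}$ with entries in $\{0,1\}$. Put $\Sigma_A=\{\alpha=(\alpha_0,\alpha_1,\dots)\in\mathcal{J}^{\mathbb{N}}:A_{\alpha_i,\alpha_{i+1}}=1\text{ for all }i=0,1,\dots\}$. $\Sigma_A$ is irreducible if for all $i,j\in\mathcal{J}$ there is a positive integer $n$ with $(A^n)_{i,j}>0$. To each $i\in\mathcal{J}$ is associated a contracting similarity $S_i(x)=r_iT_i(x)+v_i$ of $\mathbb{R}^d$ with $r_i\in(0,1)$, $T_i\in\mathbb{O}_d$ (the orthogonal group), $v_i\in\mathbb{R}^d$. For $\alpha\in\mathcal{J}^{\mathbb{N}}$ let $\Pi(\alpha)=\lim_{k\to\infty}S_{\alpha_0}\circ\cdots\circ S_{\alpha_{k-1}}(0)$. Put $F_A=\Pi(\Sigma_A)$ and $F_A^j=\Pi(\{\alpha\in\Sigma_A:\alpha_0=j\})$. The $j$-th transformation group $\mathcal{T}_{j,A}^G$ is the group generated by all $T_{\alpha_0}\circ T_{\alpha_1}\circ\cdots\circ T_{\alpha_{k-1}}$ where $k\ge1$, $(\alpha_0,\dots,\alpha_{k-1})\in\mathcal{J}^k$, $\alpha_0=j$, $A_{\alpha_i,\alpha_{i+1}}=1$ for $0\le i\le k-2$, and $A_{\alpha_{k-1},j}=1$. Self-similar systems. An SS-IFS in $\mathbb{R}^d$ is a finite collection $\{\widetilde S_i\}_{i=1}^m$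 of contracting similarities of $\mathbb{R}^d$, $\widetilde S_i(x)=\widetilde r_i\widetilde T_i(x)+\widetilde v_i$ with $0<\widetilde r_i<1$, $\widetilde T_i\in\mathbb{O}_d$, $\widetilde v_i\in\mathbb{R}^d$. Its attractor is the unique nonempty compact $K$ with $K=\bigcup_{i=1}^m\widetilde S_i(K)$; the strong separation condition (SSC) means that the sets $\widetilde S_1(K),\dots,\widetilde S_m(K)$ are pairwise disjoint. $\dim_H$ is Hausdorff dimension. *)

theory Defs
  imports "HOL-Analysis.Analysis" "HOL-Algebra.Generated_Groups" "Jordan_Normal_Form.Matrix"
begin

section \<open>Hausdorff dimension\<close>

text \<open>The summand \<open>diam(U)^s\<close>, with \<open>diam({})^s = 0\<close> and \<open>diam(U)^0 = 1\<close> for nonempty \<open>U\<close>.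
  The case \<open>s = 0\<close> is separate because \<open>0 powr 0 = 0\<close> in the library.\<close>

definition diam_pow :: "real \<Rightarrow> 'a::metric_space set \<Rightarrow> ennreal" where
  "diam_pow s U = (if U = {} then 0 else if s = 0 then 1 else ennreal (diameter U powr s))"

text \<open>Boundedness is required explicitly because \<open>diameter\<close> is \<open>0\<close> on unbounded sets.
  Finite covers are included, since \<open>U n\<close> may be empty.\<close>

definition hausdorff_premeasure :: "real \<Rightarrow> real \<Rightarrow> 'a::metric_space set \<Rightarrow> ennreal" where
  "hausdorff_premeasure s \<delta> E =
     (INF U \<in> {U :: nat \<Rightarrow> 'a set. E \<subseteq> (\<Union>n. U n) \<and> (\<forall>n. bounded (U n) \<and> diameter (U n) \<le> \<delta>)}.
        \<Sum>n. diam_pow s (U n))"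

definition hausdorff_measure :: "real \<Rightarrow> 'a::metric_space set \<Rightarrow> ennreal" where
  "hausdorff_measure s E = (SUP \<delta> \<in> {0<..}. hausdorff_premeasure s \<delta> E)"

definition hausdorff_dim :: "'a::metric_space set \<Rightarrow> ereal" where
  "hausdorff_dim E = Inf (ereal ` {s. 0 \<le> s \<and> hausdorff_measure s E = 0})"


section \<open>Families of contracting similarities\<close>

definition sim :: "('i \<Rightarrow> real) \<Rightarrow> ('i \<Rightarrow> 'a \<Rightarrow> 'a) \<Rightarrow> ('i \<Rightarrow> 'a) \<Rightarrow> 'i \<Rightarrow> 'a \<Rightarrow> 'a::euclidean_space" where
  "sim r T v i x = r i *\<^sub>R T i x + v i"

text \<open>The finite family \<open>sim r T v i\<close>, \<open>i \<in> I\<close>, consists of contracting similarities; no condition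
  is needed on the translations.\<close>

definition contracting_similarities ::
    "'i set \<Rightarrow> ('i \<Rightarrow> real) \<Rightarrow> ('i \<Rightarrow> 'a \<Rightarrow> 'a::euclidean_space) \<Rightarrow> bool" where
  "contracting_similarities I r T \<longleftrightarrow>
     finite I \<and> (\<forall>i\<in>I. 0 < r i \<and> r i < 1 \<and> orthogonal_transformation (T i))"

definition is_attractor :: "'i set \<Rightarrow> ('i \<Rightarrow> 'a \<Rightarrow> 'a) \<Rightarrow> 'a::euclidean_space set \<Rightarrow> bool" where
  "is_attractor I S K \<longleftrightarrow> K \<noteq> {} \<and> compact K \<and> K = (\<Union>i\<in>I. S i ` K)"

text \<open>Strong separation for the family \<open>S\<close> with attractor \<open>K\<close>. Disjointness is by index, so a
  map occurring twice violates it.\<close>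

definition strong_separation :: "'i set \<Rightarrow> ('i \<Rightarrow> 'a \<Rightarrow> 'a) \<Rightarrow> 'a::euclidean_space set \<Rightarrow> bool" where
  "strong_separation I S K \<longleftrightarrow> disjoint_family_on (\<lambda>i. S i ` K) I"


section \<open>Subshifts of finite type\<close>

definition zero_one_matrix :: "nat \<Rightarrow> nat mat \<Rightarrow> bool" where
  "zero_one_matrix M A \<longleftrightarrow> A \<in> carrier_mat M M \<and> (\<forall>i<M. \<forall>j<M. A $$ (i, j) \<in> {0, 1})"

definition subshift :: "nat \<Rightarrow> nat mat \<Rightarrow> (nat \<Rightarrow> nat) set" where
  "subshift M A = {\<alpha>. (\<forall>i. \<alpha> i < M) \<and> (\<forall>i. A $$ (\<alpha> i, \<alpha> (Suc i)) = 1)}"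

definition irreducible_subshift :: "nat \<Rightarrow> nat mat \<Rightarrow> bool" where
  "irreducible_subshift M A \<longleftrightarrow> (\<forall>i<M. \<forall>j<M. \<exists>n>0. (A ^\<^sub>m n) $$ (i, j) > 0)"

text \<open>\<open>comp_word f [a\<^sub>0, \<dots>, a\<^sub>k] = f a\<^sub>0 \<circ> \<dots> \<circ> f a\<^sub>k\<close>\<close>

definition comp_word :: "('i \<Rightarrow> 'a \<Rightarrow> 'a) \<Rightarrow> 'i list \<Rightarrow> 'a \<Rightarrow> 'a" where
  "comp_word f w = foldr (\<circ>) (map f w) id"

definition coding_map :: "(nat \<Rightarrow> 'a \<Rightarrow> 'a) \<Rightarrow> (nat \<Rightarrow> nat) \<Rightarrow> 'a::euclidean_space" where
  "coding_map S \<alpha> = lim (\<lambda>k. comp_word S (map \<alpha> [0..<k]) 0)"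

definition F_set :: "nat \<Rightarrow> nat mat \<Rightarrow> (nat \<Rightarrow> 'a \<Rightarrow> 'a) \<Rightarrow> 'a::euclidean_space set" where
  "F_set M A S = coding_map S ` subshift M A"

definition F_part :: "nat \<Rightarrow> nat mat \<Rightarrow> (nat \<Rightarrow> 'a \<Rightarrow> 'a) \<Rightarrow> nat \<Rightarrow> 'a::euclidean_space set" where
  "F_part M A S j = coding_map S ` {\<alpha> \<in> subshift M A. \<alpha> 0 = j}"


section \<open>Transformation groups\<close>

definition orthogonal_group :: "('a \<Rightarrow> 'a::euclidean_space) monoid" where
  "orthogonal_group = \<lparr>carrier = {f. orthogonal_transformation f}, mult = (\<circ>), one = id\<rparr>"

lemma group_orthogonal_group: "group (orthogonal_group :: ('a \<Rightarrow> 'a::euclidean_space) monoid)"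
proof (rule groupI)
  fix f :: "'a \<Rightarrow> 'a" assume "f \<in> carrier orthogonal_group"
  then have f: "orthogonal_transformation f" by (simp add: orthogonal_group_def)
  have "inv_into UNIV f \<circ> f = id"
    using orthogonal_transformation_inj[OF f] by simp
  then show "\<exists>g\<in>carrier orthogonal_group. g \<otimes>\<^bsub>orthogonal_group\<^esub> f = \<one>\<^bsub>orthogonal_group\<^esub>"
    using orthogonal_transformation_inv[OF f] by (auto simp: orthogonal_group_def)
qed (auto simp: orthogonal_group_def id_def comp_assoc
          intro: orthogonal_transformation_compose)

definition loop_words :: "nat \<Rightarrow> nat mat \<Rightarrow> nat \<Rightarrow> nat list set" where
  "loop_words M A j =
     {w. w \<noteq> [] \<and> set w \<subseteq> {..<M} \<and> hd w = j \<and>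
         (\<forall>i. Suc i < length w \<longrightarrow> A $$ (w ! i, w ! Suc i) = 1) \<and> A $$ (last w, j) = 1}"

definition transformation_group ::
    "nat \<Rightarrow> nat mat \<Rightarrow> (nat \<Rightarrow> 'a \<Rightarrow> 'a) \<Rightarrow> nat \<Rightarrow> ('a \<Rightarrow> 'a::euclidean_space) set" where
  "transformation_group M A T j = generate orthogonal_group (comp_word T ` loop_words M A j)"

end

theory Submission
  imports Defs "HOL-Library.Sublist"
begin

text \<open>
  Write \<open>D\<close> for the dimension of \<open>F = F_set M A S\<close> and take \<open>D - \<epsilon> < s < t < D\<close> with \<open>0 < s\<close>.
  A piece \<open>comp_word S w ` F_part M A S j\<close> with \<open>w\<close> a loop at \<open>j\<close> lies in \<open>F_part M A S j\<close>, so
  finitely many loops whose maps have the same ratio \<open>\<rho>\<close>, the same orthogonal part \<open>Q\<close> and pairwise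
  disjoint pieces generate a self-similar set inside \<open>F_part M A S j\<close> with strong separation. Its
  dimension is at least \<open>s\<close> as soon as the number \<open>N\<close> of loops satisfies \<open>N * \<rho> powr s \<ge> 1\<close>
  (lemmas \<open>uniform_subsystem\<close> and \<open>hausdorff_dim_limit_set_ge\<close>). It remains to find such loops.

  Let \<open>x = max_ratio ^ k\<close>. Stop every admissible sequence when the ratio of its prefix first drops to \<open>x\<close>,
  and choose a maximal family of stopped words whose cylinders are pairwise disjoint. The
  cylinders, enlarged by a constant factor, cover \<open>F\<close>; since the Hausdorff measure of \<open>F\<close> in dimension
  \<open>t\<close> does not vanish, the family has at least a constant times \<open>x powr (- t)\<close> members
  (\<open>disjoint_words_cover\<close>, \<open>finite_cover_card_ge\<close>).

  Each stopped word \<open>u\<close> is completed to a loop \<open>p u q\<close> at \<open>j\<close> with orthogonal part exactly \<open>Q\<close>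
  (\<open>loop_completion\<close>). Irreducibility supplies the connecting paths. Since the transformation group is
  finite, the orthogonal parts of loops already form a group, so a further loop at \<open>j\<close>, one of
  finitely many, corrects the orthogonal part. Hence \<open>p\<close> and \<open>q\<close> have bounded length and the ratio
  of the loop is still at least a constant times \<open>x\<close>.

  The ratio of a word depends only on how often each letter occurs, so loops of length at most
  \<open>k + L\<close> have at most \<open>(k + L + 1) ^ M\<close> different ratios, a number polynomial in \<open>k\<close>. By the
  pigeonhole principle some ratio, together with a fixed first letter of \<open>u\<close> (which fixes \<open>p\<close> and so
  preserves disjointness), is shared by a fraction of the loops that is only polynomially small in \<open>k\<close>.
  Passing from \<open>t\<close> to \<open>s\<close> gains the factor \<open>x powr (s - t)\<close>, which is exponential in \<open>k\<close> and
  outweighs that loss (\<open>exists_large_uniform_family\<close>). If \<open>D < \<epsilon>\<close>, a single loop with orthogonal part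
  \<open>Q\<close> is enough.
\<close>

section \<open>Coding maps of contracting similarities\<close>

lemma comp_word_Nil [simp]: "comp_word f [] = id"
  by (simp add: comp_word_def)

lemma comp_word_Cons [simp]: "comp_word f (a # w) = f a \<circ> comp_word f w"
  by (simp add: comp_word_def)

lemma comp_word_append: "comp_word f (u @ w) = comp_word f u \<circ> comp_word f w"
  by (induction u) (auto simp: comp_assoc)

lemma map_shift_upt: "map \<alpha> [0..<k + n] = map \<alpha> [0..<k] @ map (\<lambda>i. \<alpha> (i + k)) [0..<n]"
  by (rule nth_equalityI) (auto simp: nth_append)

locale contracting_system =
  fixes I :: "nat set" and r :: "nat \<Rightarrow> real"
    and T :: "nat \<Rightarrow> 'a \<Rightarrow> 'a::euclidean_space" and v :: "nat \<Rightarrow> 'a"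
  assumes contracting: "contracting_similarities I r T"
begin

abbreviation S :: "nat \<Rightarrow> 'a \<Rightarrow> 'a" where "S \<equiv> sim r T v"

abbreviation ratio :: "nat list \<Rightarrow> real" where "ratio w \<equiv> prod_list (map r w)"

text \<open>The value \<open>1/2\<close> keeps the extremal ratios in the open unit interval when \<open>I\<close> is empty.\<close>

definition max_ratio :: real where "max_ratio = Max (insert (1/2) (r ` I))"

definition min_ratio :: real where "min_ratio = Min (insert (1/2) (r ` I))"

text \<open>The radius is chosen so that the ball of this radius about \<open>0\<close> is mapped into itself by all maps:
  \<open>max_ratio * radius + norm (v i) \<le> radius\<close>. The summand \<open>1\<close> makes it positive.\<close>
definition radius :: real where
  "radius = (Max (insert 0 ((\<lambda>i. norm (v i)) ` I)) + 1) / (1 - max_ratio)"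

abbreviation trap :: "'a set" where "trap \<equiv> cball 0 radius"

lemma finite_I: "finite I"
  and r_pos: "i \<in> I \<Longrightarrow> 0 < r i"
  and r_less_1: "i \<in> I \<Longrightarrow> r i < 1"
  and T_orthogonal: "i \<in> I \<Longrightarrow> orthogonal_transformation (T i)"
  using contracting by (auto simp: contracting_similarities_def)

lemma r_le_max_ratio: "i \<in> I \<Longrightarrow> r i \<le> max_ratio"
  and min_ratio_le_r: "i \<in> I \<Longrightarrow> min_ratio \<le> r i"
  and max_ratio_pos: "0 < max_ratio"
  and max_ratio_less_1: "max_ratio < 1"
  and min_ratio_pos: "0 < min_ratio"
  and min_ratio_less_1: "min_ratio < 1"
proof -
  have "1/2 \<le> max_ratio" unfolding max_ratio_def using finite_I by (intro Max_ge) auto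
  then show "0 < max_ratio" by linarith
  have "min_ratio \<le> 1/2" unfolding min_ratio_def using finite_I by (intro Min_le) auto
  then show "min_ratio < 1" by linarith
  show "max_ratio < 1" "0 < min_ratio"
    using finite_I r_pos r_less_1 by (auto simp: max_ratio_def min_ratio_def)
qed (use finite_I in \<open>auto simp: max_ratio_def min_ratio_def\<close>)

lemma norm_v_le: "i \<in> I \<Longrightarrow> norm (v i) \<le> (1 - max_ratio) * radius"
  and radius_pos: "0 < radius"
proof -
  let ?m = "Max (insert 0 ((\<lambda>i. norm (v i)) ` I))"
  have "0 \<le> ?m" using finite_I by (intro Max_ge) auto
  then show "0 < radius" using max_ratio_less_1 by (simp add: radius_def)
  have eq: "(1 - max_ratio) * radius = ?m + 1" using max_ratio_less_1 by (simp add: radius_def)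
  assume "i \<in> I"
  then have "norm (v i) \<le> ?m" using finite_I by (intro Max_ge) auto
  then show "norm (v i) \<le> (1 - max_ratio) * radius" unfolding eq by linarith
qed

lemma ratio_pos: "set w \<subseteq> I \<Longrightarrow> 0 < ratio w"
  by (induction w) (auto intro!: mult_pos_pos r_pos)

lemma ratio_le_max_ratio_power: "set w \<subseteq> I \<Longrightarrow> ratio w \<le> max_ratio ^ length w"
  by (induction w)
    (auto intro!: mult_mono r_le_max_ratio less_imp_le[OF ratio_pos] less_imp_le[OF max_ratio_pos])

lemma min_ratio_power_le_ratio: "set w \<subseteq> I \<Longrightarrow> min_ratio ^ length w \<le> ratio w"
  using min_ratio_pos
  by (induction w) (auto intro!: mult_mono min_ratio_le_r less_imp_le[OF r_pos])

lemma T_comp_orthogonal: "set w \<subseteq> I \<Longrightarrow> orthogonal_transformation (comp_word T w)"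
proof (induction w)
  case (Cons a w)
  then show ?case
    unfolding comp_word_Cons by (intro orthogonal_transformation_compose T_orthogonal) auto
qed (simp add: id_def)

lemma comp_word_sim:
  assumes "set w \<subseteq> I"
  shows "comp_word S w x = ratio w *\<^sub>R comp_word T w x + comp_word S w 0"
  using assms
proof (induction w)
  case (Cons a w)
  have lin: "linear (T a)"
    using Cons.prems T_orthogonal by (auto simp: orthogonal_transformation_def)
  have step: "comp_word S (a # w) y = r a *\<^sub>R T a (comp_word S w y) + v a" for y
    by (simp add: sim_def[of r T v a])
  have "comp_word S w x = ratio w *\<^sub>R comp_word T w x + comp_word S w 0"
    using Cons by auto
  then show ?case
    unfolding step by (simp add: linear_add[OF lin] linear_scale[OF lin] scaleR_add_right)
qed simp

lemma dist_comp_word: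
  assumes "set w \<subseteq> I"
  shows "dist (comp_word S w x) (comp_word S w y) = ratio w * dist x y"
proof -
  have o: "orthogonal_transformation (comp_word T w)" by (rule T_comp_orthogonal[OF assms])
  have "comp_word S w x - comp_word S w y = ratio w *\<^sub>R (comp_word T w x - comp_word T w y)"
    by (subst (1 2) comp_word_sim[OF assms]) (simp add: scaleR_diff_right)
  also have "comp_word T w x - comp_word T w y = comp_word T w (x - y)"
    using o by (simp add: linear_diff orthogonal_transformation_linear)
  finally show ?thesis
    using ratio_pos[OF assms] orthogonal_transformation_norm[OF o]
    by (simp add: dist_norm)
qed

lemma inj_comp_word: "set w \<subseteq> I \<Longrightarrow> inj (comp_word S w)"
  using dist_comp_word[of w] ratio_pos[of w] by (intro injI) (metis less_irrefl dist_eq_0_iff mult_eq_0_iff)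

lemma S_trap:
  assumes "i \<in> I" "x \<in> trap"
  shows "S i x \<in> trap"
proof -
  have "norm (S i x) \<le> r i * norm x + norm (v i)"
    using norm_triangle_ineq[of "r i *\<^sub>R T i x" "v i"] r_pos[OF assms(1)]
      orthogonal_transformation_norm[OF T_orthogonal[OF assms(1)]]
    by (simp add: sim_def)
  also have "\<dots> \<le> max_ratio * radius + (1 - max_ratio) * radius"
    using assms max_ratio_pos
    by (intro add_mono mult_mono r_le_max_ratio norm_v_le) auto
  finally show ?thesis by (simp add: algebra_simps)
qed

lemma comp_word_trap: "set w \<subseteq> I \<Longrightarrow> x \<in> trap \<Longrightarrow> comp_word S w x \<in> trap"
proof (induction w)
  case (Cons a w)
  then show ?case unfolding comp_word_Cons o_apply by (intro S_trap) auto
qed simp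

lemma dist_trap_le: "x \<in> trap \<Longrightarrow> y \<in> trap \<Longrightarrow> dist x y \<le> 2 * radius"
  using norm_triangle_ineq4[of x y] by (auto simp: dist_norm)

lemma dist_comp_word_trap_le:
  assumes "set w \<subseteq> I" "x \<in> trap" "y \<in> trap"
  shows "dist (comp_word S w x) (comp_word S w y) \<le> 2 * radius * ratio w"
  using mult_left_mono[OF dist_trap_le[OF assms(2,3)] less_imp_le[OF ratio_pos[OF assms(1)]]]
  by (simp add: dist_comp_word[OF assms(1)] mult.commute)

lemma tendsto_max_ratio_power: "(\<lambda>k. c * max_ratio ^ k) \<longlonglongrightarrow> 0"
  using max_ratio_pos max_ratio_less_1
  by (intro tendsto_mult_right_zero LIMSEQ_power_zero) auto

lemma dist_comp_word_prefix_le: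
  assumes "\<And>i. \<alpha> i \<in> I" "k \<le> m" "k \<le> n" "x \<in> trap" "y \<in> trap"
  shows "dist (comp_word S (map \<alpha> [0..<m]) x) (comp_word S (map \<alpha> [0..<n]) y)
           \<le> 2 * radius * max_ratio ^ k"
proof -
  let ?u = "map \<alpha> [0..<k]" and ?w = "\<lambda>n. map (\<lambda>i. \<alpha> (i + k)) [0..<n - k]"
  have split: "map \<alpha> [0..<n] = ?u @ ?w n" if "k \<le> n" for n
    using map_shift_upt[of \<alpha> k "n - k"] that by simp
  have I: "set ?u \<subseteq> I" "\<And>n. set (?w n) \<subseteq> I" using assms(1) by auto
  have "dist (comp_word S ?u (comp_word S (?w m) x)) (comp_word S ?u (comp_word S (?w n) y))
      \<le> 2 * radius * ratio ?u"
    by (intro dist_comp_word_trap_le I comp_word_trap assms)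
  also have "\<dots> \<le> 2 * radius * max_ratio ^ k"
    using ratio_le_max_ratio_power[OF I(1)] radius_pos by simp
  finally show ?thesis
    unfolding split[OF assms(2)] split[OF assms(3)] comp_word_append o_apply .
qed

text \<open>The trap is mapped into itself, so the approximants from the \<open>k\<close>-th on stay in one image of the trap of
  diameter at most \<open>2 * radius * max_ratio ^ k\<close>. For the same reason the limit is independent of the
  points \<open>x k\<close> at which the compositions are evaluated.\<close>
lemma coding_map_tendsto:
  assumes \<alpha>: "\<And>i. \<alpha> i \<in> I" and x: "\<And>k. x k \<in> trap"
  shows "(\<lambda>k. comp_word S (map \<alpha> [0..<k]) (x k)) \<longlonglongrightarrow> coding_map S \<alpha>"
proof -
  let ?X = "\<lambda>k. comp_word S (map \<alpha> [0..<k]) 0"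
  have 0: "0 \<in> trap" using radius_pos by simp
  have "Cauchy ?X"
  proof (rule metric_CauchyI)
    fix e :: real assume "0 < e"
    then have "\<forall>\<^sub>F k in sequentially. 2 * radius * max_ratio ^ k < e"
      using tendsto_max_ratio_power by (rule order_tendstoD(2)[rotated])
    then obtain k where "2 * radius * max_ratio ^ k < e"
      by (auto simp: eventually_sequentially)
    then have "dist (?X m) (?X n) < e" if "k \<le> m" "k \<le> n" for m n
      using dist_comp_word_prefix_le[OF \<alpha> that 0 0] by (rule le_less_trans[rotated])
    then show "\<exists>N. \<forall>m\<ge>N. \<forall>n\<ge>N. dist (?X m) (?X n) < e" by blast
  qed
  then have lim: "?X \<longlonglongrightarrow> coding_map S \<alpha>"
    by (simp add: coding_map_def Cauchy_convergent convergent_LIMSEQ_iff[symmetric])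
  have "(\<lambda>k. dist (comp_word S (map \<alpha> [0..<k]) (x k)) (?X k)) \<longlonglongrightarrow> 0"
    using dist_comp_word_prefix_le[OF \<alpha> order_refl order_refl x 0]
    by (intro tendsto_sandwich[OF _ _ tendsto_const tendsto_max_ratio_power[of "2 * radius"]]
        always_eventually allI) simp_all
  then have "(\<lambda>k. comp_word S (map \<alpha> [0..<k]) (x k) - ?X k) \<longlonglongrightarrow> 0"
    by (simp add: dist_norm tendsto_norm_zero_iff)
  from tendsto_add[OF this lim] show ?thesis by simp
qed

lemma coding_map_trap:
  assumes "\<And>i. \<alpha> i \<in> I"
  shows "coding_map S \<alpha> \<in> trap"
proof (rule closed_sequentially[OF closed_cball])
  show "(\<lambda>k. comp_word S (map \<alpha> [0..<k]) 0) \<longlonglongrightarrow> coding_map S \<alpha>"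
    using assms radius_pos by (intro coding_map_tendsto) auto
  show "comp_word S (map \<alpha> [0..<k]) 0 \<in> trap" for k
    using assms radius_pos by (intro comp_word_trap) auto
qed

text \<open>Self-similarity of the coding map: the map of a prefix is continuous and may be taken out of the limit.\<close>
lemma coding_map_shift:
  assumes "\<And>i. \<alpha> i \<in> I"
  shows "coding_map S \<alpha> = comp_word S (map \<alpha> [0..<k]) (coding_map S (\<lambda>i. \<alpha> (i + k)))"
proof -
  let ?u = "map \<alpha> [0..<k]"
  have 0: "0 \<in> trap" using radius_pos by simp
  have u: "set ?u \<subseteq> I" using assms by auto
  have lip: "(ratio ?u)-lipschitz_on UNIV (comp_word S ?u)"
    using dist_comp_word[OF u] ratio_pos[OF u] by (auto intro!: lipschitz_onI)
  have "(\<lambda>n. comp_word S (map (\<lambda>i. \<alpha> (i + k)) [0..<n]) 0) \<longlonglongrightarrow> coding_map S (\<lambda>i. \<alpha> (i + k))"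
    using assms 0 by (intro coding_map_tendsto)
  then have "(\<lambda>n. comp_word S ?u (comp_word S (map (\<lambda>i. \<alpha> (i + k)) [0..<n]) 0))
      \<longlonglongrightarrow> comp_word S ?u (coding_map S (\<lambda>i. \<alpha> (i + k)))"
    using lipschitz_on_continuous_on[OF lip]
    by (auto intro: continuous_on_tendsto_compose)
  then have "(\<lambda>n. comp_word S (map \<alpha> [0..<n + k]) 0) \<longlonglongrightarrow> comp_word S ?u (coding_map S (\<lambda>i. \<alpha> (i + k)))"
    using map_shift_upt[of \<alpha> k] by (simp add: comp_word_append add.commute)
  moreover have "(\<lambda>n. comp_word S (map \<alpha> [0..<n + k]) 0) \<longlonglongrightarrow> coding_map S \<alpha>"
    using LIMSEQ_ignore_initial_segment[OF coding_map_tendsto[of \<alpha> "\<lambda>_. 0"]] assms 0 by simp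
  ultimately show ?thesis using LIMSEQ_unique by blast
qed

lemma dist_coding_map_le:
  assumes "\<And>i. \<alpha> i \<in> I" "\<And>i. \<beta> i \<in> I" "map \<alpha> [0..<k] = map \<beta> [0..<k]"
  shows "dist (coding_map S \<alpha>) (coding_map S \<beta>) \<le> 2 * radius * max_ratio ^ k"
proof -
  have I: "set (map \<alpha> [0..<k]) \<subseteq> I" using assms by auto
  have "dist (coding_map S \<alpha>) (coding_map S \<beta>) \<le> 2 * radius * ratio (map \<alpha> [0..<k])"
    unfolding coding_map_shift[of \<alpha> k, OF assms(1)] coding_map_shift[of \<beta> k, OF assms(2)] assms(3)[symmetric]
    by (intro dist_comp_word_trap_le I coding_map_trap assms)
  also have "\<dots> \<le> 2 * radius * max_ratio ^ k"
    using ratio_le_max_ratio_power[OF I] radius_pos by simp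
  finally show ?thesis .
qed

lemma continuous_on_coding_map: "continuous_on {\<alpha>. \<forall>i. \<alpha> i \<in> I} (coding_map S)"
  unfolding continuous_on_topological
proof (intro ballI allI impI)
  fix \<alpha> :: "nat \<Rightarrow> nat" and B :: "'a set"
  assume \<alpha>: "\<alpha> \<in> {\<alpha>. \<forall>i. \<alpha> i \<in> I}" and B: "open B" "coding_map S \<alpha> \<in> B"
  then obtain e where e: "0 < e" "ball (coding_map S \<alpha>) e \<subseteq> B" by (auto simp: open_contains_ball)
  then have "\<forall>\<^sub>F k in sequentially. 2 * radius * max_ratio ^ k < e"
    using tendsto_max_ratio_power by (intro order_tendstoD(2)[rotated])
  then obtain k where k: "2 * radius * max_ratio ^ k < e" by (auto simp: eventually_sequentially)
  let ?A = "{\<beta>. \<forall>i\<in>{..<k}. \<beta> i \<in> {\<alpha> i}}"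
  have "open ?A" by (rule product_topology_basis') (auto simp: open_discrete)
  moreover have "coding_map S \<beta> \<in> B" if "\<forall>i. \<beta> i \<in> I" "\<beta> \<in> ?A" for \<beta>
  proof -
    have "map \<alpha> [0..<k] = map \<beta> [0..<k]" using that by auto
    then have "dist (coding_map S \<alpha>) (coding_map S \<beta>) < e"
      using dist_coding_map_le[of \<alpha> \<beta> k] \<alpha> that k by fastforce
    then show ?thesis using e by auto
  qed
  ultimately show "\<exists>A. open A \<and> \<alpha> \<in> A \<and>
      (\<forall>\<beta>\<in>{\<alpha>. \<forall>i. \<alpha> i \<in> I}. \<beta> \<in> A \<longrightarrow> coding_map S \<beta> \<in> B)"
    by (intro exI[of _ ?A]) auto
qed

text \<open>By Tychonoff the sequences over a finite alphabet form a compact space.\<close>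
lemma compact_coding_map_image:
  assumes "closed X" "\<And>\<alpha> i. \<alpha> \<in> X \<Longrightarrow> \<alpha> i \<in> I"
  shows "compact (coding_map S ` X)"
proof -
  have "compactin (product_topology (\<lambda>i. euclidean) UNIV) (PiE UNIV (\<lambda>i::nat. I))"
    by (simp add: compactin_PiE finite_imp_compact finite_I)
  then have "compact (PiE UNIV (\<lambda>i::nat. I))"
    by (simp add: euclidean_product_topology)
  also have "PiE UNIV (\<lambda>i::nat. I) = {\<alpha>. \<forall>i. \<alpha> i \<in> I}" by (auto simp: PiE_def)
  finally have "compact ({\<alpha>. \<forall>i. \<alpha> i \<in> I} \<inter> X)" using assms(1) by (rule compact_Int_closed)
  also have "{\<alpha>. \<forall>i. \<alpha> i \<in> I} \<inter> X = X" using assms(2) by auto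
  finally show ?thesis
    using assms(2) by (intro compact_continuous_image continuous_on_subset[OF continuous_on_coding_map]) auto
qed

definition limit_set :: "'a set" where
  "limit_set = coding_map S ` {\<alpha>. \<forall>i. \<alpha> i \<in> I}"

lemma compact_limit_set: "compact limit_set"
proof -
  have "closed (\<Inter>i. (\<lambda>\<alpha>. \<alpha> i) -` I)"
    by (intro closed_INT ballI closed_vimage continuous_on_product_coordinates finite_imp_closed finite_I)
  also have "(\<Inter>i. (\<lambda>\<alpha>. \<alpha> i) -` I) = {\<alpha>. \<forall>i::nat. \<alpha> i \<in> I}" by auto
  finally show ?thesis unfolding limit_set_def by (rule compact_coding_map_image) auto
qed

lemma limit_set_subset_trap: "limit_set \<subseteq> trap"
  using coding_map_trap by (auto simp: limit_set_def simp del: mem_cball)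

lemma is_attractor_limit_set:
  assumes "I \<noteq> {}"
  shows "is_attractor I S limit_set"
  unfolding is_attractor_def
proof (intro conjI compact_limit_set)
  obtain i where "i \<in> I" using assms by auto
  then have "coding_map S (\<lambda>_. i) \<in> limit_set" by (auto simp: limit_set_def)
  then show "limit_set \<noteq> {}" by auto
  show "limit_set = (\<Union>i\<in>I. S i ` limit_set)"
  proof (intro equalityI subsetI)
    fix x assume "x \<in> limit_set"
    then obtain \<alpha> where \<alpha>: "\<And>i. \<alpha> i \<in> I" "x = coding_map S \<alpha>" by (auto simp: limit_set_def)
    then have "x = S (\<alpha> 0) (coding_map S (\<lambda>i. \<alpha> (Suc i)))"
      using coding_map_shift[of \<alpha> 1] by simp
    then show "x \<in> (\<Union>i\<in>I. S i ` limit_set)" using \<alpha> by (auto simp: limit_set_def)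
  next
    fix x assume "x \<in> (\<Union>i\<in>I. S i ` limit_set)"
    then obtain i \<alpha> where \<alpha>: "i \<in> I" "\<And>i. \<alpha> i \<in> I" "x = S i (coding_map S \<alpha>)"
      by (auto simp: limit_set_def)
    then have *: "case_nat i \<alpha> k \<in> I" for k by (auto split: nat.split)
    have "x = coding_map S (case_nat i \<alpha>)"
      using coding_map_shift[of "case_nat i \<alpha>" 1] * \<alpha> by simp
    then show "x \<in> limit_set" using * by (auto simp: limit_set_def)
  qed
qed

text \<open>A coded point is the limit of the images of any starting point; starting in \<open>F\<close>, these never leave \<open>F\<close>.\<close>
lemma limit_set_subset_closed:
  assumes F: "closed F" "F \<noteq> {}" and inv: "\<And>i. i \<in> I \<Longrightarrow> S i ` F \<subseteq> F"
  shows "limit_set \<subseteq> F"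
proof
  fix x assume "x \<in> limit_set"
  then obtain \<alpha> where \<alpha>: "\<And>i. \<alpha> i \<in> I" "x = coding_map S \<alpha>" by (auto simp: limit_set_def)
  obtain y where y: "y \<in> F" using F by auto
  have F_word: "comp_word S w y \<in> F" if "set w \<subseteq> I" for w
    using that by (induction w) (use inv y in auto)
  have "(\<lambda>k. comp_word S (map \<alpha> [0..<k]) y - comp_word S (map \<alpha> [0..<k]) 0) \<longlonglongrightarrow> 0"
  proof (rule Lim_null_comparison[OF _ tendsto_max_ratio_power[of "norm y"]], rule always_eventually, rule allI)
    fix k
    have I: "set (map \<alpha> [0..<k]) \<subseteq> I" using \<alpha> by auto
    show "norm (comp_word S (map \<alpha> [0..<k]) y - comp_word S (map \<alpha> [0..<k]) 0)
        \<le> norm y * max_ratio ^ k"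
      using dist_comp_word[OF I, of y 0] ratio_le_max_ratio_power[OF I]
      by (simp add: dist_norm mult.commute mult_left_mono)
  qed
  from tendsto_add[OF this coding_map_tendsto[of \<alpha> "\<lambda>_. 0"]]
  have "(\<lambda>k. comp_word S (map \<alpha> [0..<k]) y) \<longlonglongrightarrow> x" using \<alpha> radius_pos by simp
  moreover have "comp_word S (map \<alpha> [0..<k]) y \<in> F" for k using \<alpha> by (intro F_word) auto
  ultimately show "x \<in> F" by (rule closed_sequentially[OF F(1), rotated])
qed

end

section \<open>Hausdorff measure and dimension\<close>

lemma diam_pow_pos_exponent: "0 < s \<Longrightarrow> diam_pow s U = ennreal (diameter U powr s)"
  by (simp add: diam_pow_def)

lemma hausdorff_dim_nonneg: "0 \<le> hausdorff_dim E"
  unfolding hausdorff_dim_def by (intro Inf_greatest) auto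

lemma hausdorff_dim_ge:
  assumes "\<And>t. 0 \<le> t \<Longrightarrow> t < s \<Longrightarrow> hausdorff_measure t E \<noteq> 0"
  shows "ereal s \<le> hausdorff_dim E"
  unfolding hausdorff_dim_def
  using assms by (intro Inf_greatest) (force simp: not_less[symmetric])

lemma hausdorff_measure_nonzeroI:
  fixes E :: "'a::metric_space set"
  assumes "0 < c" "0 < (\<delta> :: real)"
    and "\<And>U. E \<subseteq> (\<Union>n. U n) \<Longrightarrow> (\<And>n. bounded (U n)) \<Longrightarrow> c \<le> (\<Sum>n. diam_pow s (U n))"
  shows "hausdorff_measure s E \<noteq> 0"
proof -
  have "c \<le> hausdorff_premeasure s \<delta> E"
    unfolding hausdorff_premeasure_def by (rule INF_greatest) (auto intro!: assms(3))
  also have "\<dots> \<le> hausdorff_measure s E"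
    unfolding hausdorff_measure_def using assms(2) by (intro SUP_upper) auto
  finally show ?thesis using assms(1) by auto
qed

lemma hausdorff_measure_0_nonzero:
  fixes E :: "'a::metric_space set"
  assumes "E \<noteq> {}"
  shows "hausdorff_measure 0 E \<noteq> 0"
proof (rule hausdorff_measure_nonzeroI[of 1 1])
  fix U :: "nat \<Rightarrow> 'a set"
  assume "E \<subseteq> (\<Union>n. U n)"
  then obtain n where "U n \<noteq> {}" using assms by fastforce
  then have "1 \<le> (\<Sum>m\<in>{n}. diam_pow 0 (U m))" by (simp add: diam_pow_def)
  also have "\<dots> \<le> (\<Sum>m. diam_pow 0 (U m))" by (intro sum_le_suminf) auto
  finally show "1 \<le> (\<Sum>m. diam_pow 0 (U m))" .
qed auto

lemma hausdorff_premeasure_finite_cover_le: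
  fixes E :: "'a::metric_space set"
  assumes fin: "finite V" and cover: "E \<subseteq> (\<Union>u\<in>V. C u)"
    and C: "\<And>u. u \<in> V \<Longrightarrow> bounded (C u)" "\<And>u. u \<in> V \<Longrightarrow> diameter (C u) \<le> d"
    and d: "0 \<le> d" "d \<le> \<delta>" and s: "0 < s"
  shows "hausdorff_premeasure s \<delta> E \<le> ennreal (card V * d powr s)"
proof -
  obtain h where h: "bij_betw h {0..<card V} V" using ex_bij_betw_nat_finite[OF fin] by auto
  define U where "U n = (if n < card V then C (h n) else {})" for n
  have hV: "h n \<in> V" if "n < card V" for n using h that by (auto simp: bij_betw_def)
  have "E \<subseteq> (\<Union>n. U n)"
  proof
    fix x assume "x \<in> E"
    then obtain u where u: "u \<in> V" "x \<in> C u" using cover by auto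
    moreover obtain n where "n < card V" "u = h n" using h u(1) by (force simp: bij_betw_def)
    ultimately show "x \<in> (\<Union>n. U n)" by (auto simp: U_def)
  qed
  moreover have "bounded (U n) \<and> diameter (U n) \<le> \<delta>" for n
    using C(1)[OF hV] order_trans[OF C(2)[OF hV] d(2)] d by (simp add: U_def)
  ultimately have "hausdorff_premeasure s \<delta> E \<le> (\<Sum>n. diam_pow s (U n))"
    unfolding hausdorff_premeasure_def by (intro INF_lower) auto
  also have "\<dots> = (\<Sum>n<card V. diam_pow s (U n))"
    by (intro suminf_finite) (auto simp: U_def diam_pow_def)
  also have "\<dots> \<le> (\<Sum>n<card V. ennreal (d powr s))"
  proof (rule sum_mono)
    fix n assume "n \<in> {..<card V}"
    then have "diameter (U n) powr s \<le> d powr s"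
      using C[OF hV] s by (intro powr_mono2) (auto simp: U_def diameter_ge_0)
    then show "diam_pow s (U n) \<le> ennreal (d powr s)"
      by (simp add: diam_pow_pos_exponent[OF s] ennreal_leI)
  qed
  also have "\<dots> = ennreal (card V * d powr s)"
    by (simp add: ennreal_of_nat_eq_real_of_nat ennreal_mult')
  finally show ?thesis .
qed

text \<open>Some premeasure of \<open>E\<close> is positive, and it bounds the sum \<open>card V * d powr s\<close> from below for all
  covers at that scale; so \<open>card V\<close> grows at least like \<open>d powr (- s)\<close>.\<close>
lemma finite_cover_card_ge:
  fixes E :: "'a::metric_space set"
  assumes "hausdorff_measure s E \<noteq> 0" "0 < s"
  obtains c \<delta> where "0 < c" "0 < \<delta>"
    "\<And>(V :: 'i set) C d. finite V \<Longrightarrow> E \<subseteq> (\<Union>u\<in>V. C u) \<Longrightarrow> (\<And>u. u \<in> V \<Longrightarrow> bounded (C u)) \<Longrightarrow>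
       (\<And>u. u \<in> V \<Longrightarrow> diameter (C u) \<le> d) \<Longrightarrow> 0 \<le> d \<Longrightarrow> d \<le> \<delta> \<Longrightarrow> c \<le> card V * d powr s"
proof -
  have "\<exists>\<delta>>0. hausdorff_premeasure s \<delta> E \<noteq> 0"
  proof (rule ccontr)
    assume "\<not> ?thesis"
    then have "hausdorff_measure s E \<le> 0"
      unfolding hausdorff_measure_def by (intro SUP_least) auto
    then show False using assms by simp
  qed
  then obtain \<delta> where \<delta>: "0 < \<delta>" "hausdorff_premeasure s \<delta> E \<noteq> 0" by auto
  then obtain c where c: "0 < c" "ennreal c \<le> hausdorff_premeasure s \<delta> E"
  proof (cases "hausdorff_premeasure s \<delta> E")
    case (real x)
    then show ?thesis using that[of x] \<delta> by (auto simp: less_le)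
  qed (use that[of 1] in auto)
  show ?thesis
  proof (rule that[OF c(1) \<delta>(1)])
    fix V :: "'i set" and C d
    assume *: "finite V" "E \<subseteq> (\<Union>u\<in>V. C u)" "\<And>u. u \<in> V \<Longrightarrow> bounded (C u)"
      "\<And>u. u \<in> V \<Longrightarrow> diameter (C u) \<le> d" "0 \<le> d" "d \<le> \<delta>"
    have "ennreal c \<le> ennreal (card V * d powr s)"
      using hausdorff_premeasure_finite_cover_le[OF *(1-6) assms(2)] c(2) by (rule order_trans[rotated])
    then show "c \<le> card V * d powr s" by (simp add: ennreal_le_iff)
  qed
qed

section \<open>A lower bound for the dimension of separated self-similar sets\<close>

text \<open>A companion of Kraft's inequality for the tree of words over \<open>I\<close>: prefixes of total weight below \<open>1\<close>
  cannot block all infinite sequences. Give the word \<open>w n\<close> the weight \<open>q ^ length (w n)\<close>, where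
  \<open>q = 1 / card I\<close>, and let \<open>J u\<close> be the total weight of the words \<open>w n\<close> that extend \<open>u\<close>. If
  \<open>J u < q ^ length u\<close>, then one of the \<open>card I\<close> children of \<open>u\<close> inherits the inequality; following such
  children gives a sequence that never runs into a \<open>w n\<close>, because \<open>J (w n) \<ge> q ^ length (w n)\<close>.
  Below it takes the role of the mass distribution principle: prefixes are weighed instead of sets.\<close>
lemma sequence_avoiding_prefixes:
  fixes w :: "nat \<Rightarrow> 'i list"
  assumes fin: "finite I" and ne: "I \<noteq> {}"
    and sum_less: "(\<Sum>n. ennreal ((1 / card I) ^ length (w n))) < 1"
  shows "\<exists>\<beta>. (\<forall>i. \<beta> i \<in> I) \<and> (\<forall>n. map \<beta> [0..<length (w n)] \<noteq> w n)"
proof -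
  define q where "q = 1 / real (card I)"
  have card: "0 < card I" using fin ne by (simp add: card_gt_0_iff)
  then have q: "0 < q" "card I * q = 1" by (auto simp: q_def)
  define J where "J u = (\<Sum>n. if prefix u (w n) then ennreal (q ^ length (w n)) else 0)" for u
  have step: "\<exists>i\<in>I. J (u @ [i]) < ennreal (q ^ Suc (length u))"
    if u: "J u < ennreal (q ^ length u)" for u
  proof (rule ccontr)
    assume "\<not> ?thesis"
    then have "ennreal (q ^ Suc (length u)) \<le> J (u @ [i])" if "i \<in> I" for i
      using that by auto
    then have "(\<Sum>i\<in>I. ennreal (q ^ Suc (length u))) \<le> (\<Sum>i\<in>I. J (u @ [i]))"
      by (rule sum_mono)
    also have "\<dots> = (\<Sum>n. \<Sum>i\<in>I. if prefix (u @ [i]) (w n) then ennreal (q ^ length (w n)) else 0)"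
      unfolding J_def by (rule suminf_sum[symmetric]) simp
    also have "\<dots> \<le> J u"
      unfolding J_def
    proof (intro suminf_le summableI)
      fix n
      let ?c = "ennreal (q ^ length (w n))"
      show "(\<Sum>i\<in>I. if prefix (u @ [i]) (w n) then ?c else 0) \<le> (if prefix u (w n) then ?c else 0)"
      proof (cases "\<exists>i\<in>I. prefix (u @ [i]) (w n)")
        case True
        then obtain i where i: "i \<in> I" "prefix (u @ [i]) (w n)" by auto
        then have "prefix (u @ [k]) (w n) \<longleftrightarrow> i = k" for k
          by (auto simp: prefix_def)
        moreover have "prefix u (w n)" using i by (auto simp: prefix_def)
        ultimately show ?thesis using fin i by simp
      next
        case False
        then have "(\<Sum>i\<in>I. if prefix (u @ [i]) (w n) then ?c else 0) = 0"
          by (intro sum.neutral) auto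
        then show ?thesis by simp
      qed
    qed
    also note u
    also have "ennreal (q ^ length u) = (\<Sum>i\<in>I. ennreal (q ^ Suc (length u)))"
      using q by (simp add: ennreal_of_nat_eq_real_of_nat ennreal_mult'[symmetric] mult.assoc[symmetric])
    finally show False by simp
  qed
  define P where "P n u \<longleftrightarrow> length u = n \<and> J u < ennreal (q ^ n)" for n u
  have "\<exists>f. \<forall>n. P n (f n) \<and> (\<exists>i\<in>I. f (Suc n) = f n @ [i])"
  proof (rule dependent_nat_choice)
    have "P 0 []" using sum_less by (simp add: P_def J_def q_def)
    then show "\<exists>u. P 0 u" ..
    fix u n assume "P n u"
    with step[of u] obtain i where "i \<in> I" "P (Suc n) (u @ [i])" by (auto simp: P_def)
    then show "\<exists>y. P (Suc n) y \<and> (\<exists>i\<in>I. y = u @ [i])" by auto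
  qed
  then obtain f where f: "\<And>n. P n (f n)" "\<And>n. \<exists>i\<in>I. f (Suc n) = f n @ [i]" by auto
  define \<beta> where "\<beta> n = last (f (Suc n))" for n
  have \<beta>: "\<beta> n \<in> I" "f (Suc n) = f n @ [\<beta> n]" for n using f(2)[of n] by (auto simp: \<beta>_def)
  have prefix_f: "map \<beta> [0..<n] = f n" for n
  proof (induction n)
    case 0
    show ?case using f(1)[of 0] by (simp add: P_def)
  qed (simp add: \<beta>(2))
  have "map \<beta> [0..<length (w n)] \<noteq> w n" for n
  proof
    assume "map \<beta> [0..<length (w n)] = w n"
    then have "P (length (w n)) (w n)" using f(1) prefix_f by metis
    then have "J (w n) < ennreal (q ^ length (w n))" by (simp add: P_def)
    moreover have "ennreal (q ^ length (w n)) \<le> J (w n)"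
      unfolding J_def using sum_le_suminf[OF summableI, of "{n}"
        "\<lambda>m. if prefix (w n) (w m) then ennreal (q ^ length (w m)) else 0"] by simp
    ultimately show False by simp
  qed
  with \<beta> show ?thesis by auto
qed

text \<open>The level \<open>l\<close> of the cylinders that a set of diameter \<open>d\<close> is compared with. The summand \<open>e\<close> takes care of
  \<open>d = 0\<close>, where every level is fine enough and none is the last.\<close>
lemma geometric_scale:
  fixes d g \<rho> s e :: real
  assumes "0 < \<rho>" "\<rho> < 1" "0 < g" "0 < s" "0 < e" "0 \<le> d"
  shows "\<exists>l. (l = 0 \<or> d < g * \<rho> ^ l) \<and> (\<rho> powr s) ^ l \<le> (d / (g * \<rho>)) powr s + e"
proof -
  have small: "\<exists>l. (\<rho> powr t) ^ l < c" if "0 < c" "0 < t" for t c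
    using assms that powr_less_mono2[of t \<rho> 1] by (intro real_arch_pow_inv) auto
  consider "g \<le> d" | "d = 0" | "0 < d" "d < g" using assms by linarith
  then show ?thesis
  proof cases
    case 1
    have "g * \<rho> \<le> g * 1" using assms by (intro mult_left_mono) auto
    then have "g * \<rho> \<le> d" using 1 by linarith
    then have "1 \<le> d / (g * \<rho>)" using assms by (simp add: le_divide_eq)
    then have "1 \<le> (d / (g * \<rho>)) powr s" using assms by (simp add: ge_one_powr_ge_zero)
    then show ?thesis using assms by (intro exI[of _ 0]) auto
  next
    case 2
    with small[of e s] assms show ?thesis by (auto intro: less_imp_le)
  next
    case 3
    have ex: "\<exists>l. g * \<rho> ^ l \<le> d"
      using small[of "d / g" 1] assms 3 by (auto simp: field_simps powr_one intro: less_imp_le)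
    define l where "l = (LEAST l. g * \<rho> ^ l \<le> d)"
    have l: "g * \<rho> ^ l \<le> d" unfolding l_def by (rule LeastI_ex[OF ex])
    then have "l \<noteq> 0" using 3 by (intro notI) simp
    then obtain l' where l': "l = Suc l'" using not0_implies_Suc by blast
    have "d < g * \<rho> ^ l'"
      using not_less_Least[of l' "\<lambda>l. g * \<rho> ^ l \<le> d"] l' by (simp add: l_def)
    moreover have "\<rho> ^ l' \<le> d / (g * \<rho>)" using l assms by (simp add: l' field_simps)
    then have "(\<rho> ^ l') powr s \<le> (d / (g * \<rho>)) powr s"
      using assms by (intro powr_mono2) auto
    then have "(\<rho> powr s) ^ l' \<le> (d / (g * \<rho>)) powr s"
      using assms by (simp add: powr_power powr_powr powr_realpow[symmetric] mult.commute)
    ultimately show ?thesis using assms by (intro exI[of _ l']) auto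
  qed
qed

context contracting_system begin

lemma separated_pieces_gap:
  assumes "strong_separation I S limit_set"
  shows "\<exists>g>0. \<forall>i\<in>I. \<forall>j\<in>I. i \<noteq> j \<longrightarrow> (\<forall>x\<in>S i ` limit_set. \<forall>y\<in>S j ` limit_set. g \<le> dist x y)"
proof -
  let ?D = "{p \<in> I \<times> I. fst p \<noteq> snd p}"
  have cont: "continuous_on UNIV (S i)" if "i \<in> I" for i
  proof -
    have "continuous_on UNIV (T i)"
      using T_orthogonal[OF that] by (simp add: linear_continuous_on linear_linear orthogonal_transformation_linear)
    then have "continuous_on UNIV (\<lambda>x. r i *\<^sub>R T i x + v i)" by (intro continuous_intros)
    then show ?thesis by (simp add: sim_def[abs_def])
  qed
  have gap: "\<exists>g>0. \<forall>x\<in>S (fst p) ` limit_set. \<forall>y\<in>S (snd p) ` limit_set. g \<le> dist x y"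
    if "p \<in> ?D" for p
  proof (rule separate_compact_closed)
    have comp: "compact (S i ` limit_set)" if "i \<in> I" for i
      using cont[OF that] compact_limit_set by (auto intro: compact_continuous_image continuous_on_subset)
    show "compact (S (fst p) ` limit_set)" "closed (S (snd p) ` limit_set)"
      using comp that by (auto intro: compact_imp_closed)
    show "S (fst p) ` limit_set \<inter> S (snd p) ` limit_set = {}"
      using assms that unfolding strong_separation_def disjoint_family_on_def by (simp add: mem_Times_iff)
  qed
  have "\<exists>h. \<forall>p\<in>?D. 0 < h p \<and> (\<forall>x\<in>S (fst p) ` limit_set. \<forall>y\<in>S (snd p) ` limit_set. h p \<le> dist x y)"
    by (rule bchoice) (use gap in blast)
  then obtain h where h: "\<forall>p\<in>?D. 0 < h p \<and>
      (\<forall>x\<in>S (fst p) ` limit_set. \<forall>y\<in>S (snd p) ` limit_set. h p \<le> dist x y)" ..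
  have fin: "finite ?D" using finite_I by (auto intro: finite_subset[of _ "I \<times> I"])
  define g where "g = Min (insert 1 (h ` ?D))"
  have "0 < g" using fin h by (simp add: g_def)
  moreover have "g \<le> dist x y" if "i \<in> I" "j \<in> I" "i \<noteq> j" "x \<in> S i ` limit_set" "y \<in> S j ` limit_set" for i j x y
  proof -
    have "g \<le> h (i, j)" unfolding g_def using fin that by (intro Min_le) auto
    also have "\<dots> \<le> dist x y" using bspec[OF h, of "(i, j)"] that by auto
    finally show ?thesis .
  qed
  ultimately show ?thesis by (intro exI[of _ g]) blast
qed

text \<open>Distinct cylinders of level \<open>l\<close> are at distance at least a constant times \<open>\<rho> ^ l\<close>, so all points of
  the limit set in a set \<open>U n\<close> of the cover share their first \<open>l n\<close> letters, for a level \<open>l n\<close> chosen so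
  that \<open>\<rho> ^ l n\<close> is at most comparable to the diameter, up to a summable error. If the sum of the
  powers of the diameters were small, these prefixes would have total weight below \<open>1\<close>, and a sequence
  avoiding all of them would code an uncovered point.\<close>
lemma hausdorff_measure_limit_set_nonzero:
  assumes ne: "I \<noteq> {}" and ssc: "strong_separation I S limit_set"
    and \<rho>: "0 < \<rho>" "\<rho> < 1" "\<And>i. i \<in> I \<Longrightarrow> r i = \<rho>"
    and s: "0 < s" "1 \<le> card I * \<rho> powr s"
  shows "hausdorff_measure s limit_set \<noteq> 0"
proof -
  obtain g where g: "0 < g" and gap: "\<And>i j x y. i \<in> I \<Longrightarrow> j \<in> I \<Longrightarrow> i \<noteq> j \<Longrightarrow>
      x \<in> S i ` limit_set \<Longrightarrow> y \<in> S j ` limit_set \<Longrightarrow> g \<le> dist x y"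
    using separated_pieces_gap[OF ssc] by metis
  have ratio_eq: "ratio w = \<rho> ^ length w" if "set w \<subseteq> I" for w
    using that by (induction w) (auto simp: \<rho>)
  \<comment> \<open>If the sequences first differ at position \<open>k\<close>, their points are \<open>\<rho> ^ k\<close> times as far apart as two
    points in different first-level pieces.\<close>
  have agree: "map \<alpha> [0..<l] = map \<beta> [0..<l]"
    if I: "\<And>i. \<alpha> i \<in> I" "\<And>i. \<beta> i \<in> I" and less: "dist (coding_map S \<alpha>) (coding_map S \<beta>) < g * \<rho> ^ l" for \<alpha> \<beta> l
  proof (rule ccontr)
    assume "\<not> ?thesis"
    then have ex: "\<exists>k<l. \<alpha> k \<noteq> \<beta> k" by auto
    define k where "k = (LEAST k. \<alpha> k \<noteq> \<beta> k)"
    obtain k' where k': "k' < l" "\<alpha> k' \<noteq> \<beta> k'" using ex by auto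
    have k: "\<alpha> k \<noteq> \<beta> k" unfolding k_def using k'(2) by (rule LeastI)
    have "k \<le> k'" unfolding k_def using k'(2) by (rule Least_le)
    then have kl: "k < l" using k'(1) by simp
    have pre: "map \<alpha> [0..<k] = map \<beta> [0..<k]"
      using not_less_Least[of _ "\<lambda>k. \<alpha> k \<noteq> \<beta> k", folded k_def] by simp
    have u: "set (map \<alpha> [0..<k]) \<subseteq> I" using I by auto
    let ?x = "coding_map S (\<lambda>i. \<alpha> (i + k))" and ?y = "coding_map S (\<lambda>i. \<beta> (i + k))"
    have "?x \<in> S (\<alpha> k) ` limit_set" "?y \<in> S (\<beta> k) ` limit_set"
      using coding_map_shift[of "\<lambda>i. \<alpha> (i + k)" 1] coding_map_shift[of "\<lambda>i. \<beta> (i + k)" 1] I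
      by (auto simp: limit_set_def)
    then have "g \<le> dist ?x ?y" using I k by (intro gap)
    then have "\<rho> ^ l * g \<le> \<rho> ^ k * dist ?x ?y"
      using \<rho> g kl by (intro mult_mono power_decreasing) auto
    also have "\<dots> = dist (coding_map S \<alpha>) (coding_map S \<beta>)"
      unfolding coding_map_shift[of \<alpha> k, OF I(1)] coding_map_shift[of \<beta> k, OF I(2)] pre[symmetric]
      unfolding dist_comp_word[OF u] ratio_eq[OF u] by simp
    finally show False using less by (simp add: mult.commute)
  qed
  define c where "c = (g * \<rho>) powr s"
  have c: "0 < c" using g \<rho> by (simp add: c_def)
  show ?thesis
  proof (rule hausdorff_measure_nonzeroI[of "ennreal (c / 2)" 1])
    show "0 < ennreal (c / 2)" using c by simp
    fix U :: "nat \<Rightarrow> 'a set"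
    assume cover: "limit_set \<subseteq> (\<Union>n. U n)" and bdd: "\<And>n. bounded (U n)"
    show "ennreal (c / 2) \<le> (\<Sum>n. diam_pow s (U n))"
    proof (rule ccontr)
      assume "\<not> ?thesis"
      then have small: "(\<Sum>n. ennreal (diameter (U n) powr s)) < ennreal (c / 2)"
        by (simp add: diam_pow_pos_exponent[OF s(1)] not_le)
      define e :: "nat \<Rightarrow> real" where "e n = (1/2) ^ (n + 2)" for n
      have "\<exists>l. (l = 0 \<or> diameter (U n) < g * \<rho> ^ l) \<and>
          (\<rho> powr s) ^ l \<le> (diameter (U n) / (g * \<rho>)) powr s + e n" for n
        using \<rho> g s bdd by (intro geometric_scale) (auto simp: e_def diameter_ge_0)
      then obtain l where l: "\<And>n. l n = 0 \<or> diameter (U n) < g * \<rho> ^ l n"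
        "\<And>n. (\<rho> powr s) ^ l n \<le> (diameter (U n) / (g * \<rho>)) powr s + e n"
        by metis
      \<comment> \<open>A set \<open>U n\<close> that misses the limit set gets an arbitrary word of length \<open>l n\<close>.\<close>
      have "\<exists>w. length w = l n \<and> (\<forall>\<alpha>. (\<forall>i. \<alpha> i \<in> I) \<and> coding_map S \<alpha> \<in> U n \<longrightarrow> map \<alpha> [0..<l n] = w)" for n
      proof (cases "\<exists>\<alpha>. (\<forall>i. \<alpha> i \<in> I) \<and> coding_map S \<alpha> \<in> U n")
        case True
        then obtain \<alpha> where \<alpha>: "\<And>i. \<alpha> i \<in> I" "coding_map S \<alpha> \<in> U n" by auto
        have "map \<beta> [0..<l n] = map \<alpha> [0..<l n]" if "\<forall>i. \<beta> i \<in> I" "coding_map S \<beta> \<in> U n" for \<beta>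
          using l(1)[of n] agree[of \<beta> \<alpha> "l n"] \<alpha> that
            diameter_bounded_bound[OF bdd, of "coding_map S \<beta>" n "coding_map S \<alpha>"] by fastforce
        then show ?thesis by (intro exI[of _ "map \<alpha> [0..<l n]"]) auto
      next
        case False
        then show ?thesis by (intro exI[of _ "replicate (l n) 0"]) auto
      qed
      then obtain w where w: "\<And>n. length (w n) = l n"
        "\<And>n \<alpha>. (\<And>i. \<alpha> i \<in> I) \<Longrightarrow> coding_map S \<alpha> \<in> U n \<Longrightarrow> map \<alpha> [0..<l n] = w n"
        by metis
      have card: "0 < card I" using finite_I ne by (simp add: card_gt_0_iff)
      have "(\<Sum>n. ennreal ((1 / card I) ^ length (w n)))
          \<le> (\<Sum>n. ennreal (1 / c) * ennreal (diameter (U n) powr s) + ennreal (e n))"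
      proof (intro suminf_le summableI)
        fix n
        have "1 / card I \<le> \<rho> powr s" using s(2) card by (simp add: field_simps)
        then have "(1 / card I) ^ length (w n) \<le> (\<rho> powr s) ^ l n"
          unfolding w(1) by (intro power_mono) auto
        also have "\<dots> \<le> (diameter (U n) / (g * \<rho>)) powr s + e n" by (rule l(2))
        also have "\<dots> = 1 / c * diameter (U n) powr s + e n"
          using g \<rho> bdd by (simp add: c_def powr_divide diameter_ge_0)
        finally have "ennreal ((1 / card I) ^ length (w n)) \<le> ennreal (1 / c * diameter (U n) powr s + e n)"
          by (rule ennreal_leI)
        also have "\<dots> = ennreal (1 / c) * ennreal (diameter (U n) powr s) + ennreal (e n)"
          using c by (simp add: e_def ennreal_plus[symmetric] ennreal_mult'[symmetric] del: ennreal_plus)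
        finally show "ennreal ((1 / card I) ^ length (w n))
            \<le> ennreal (1 / c) * ennreal (diameter (U n) powr s) + ennreal (e n)" .
      qed
      also have "\<dots> = ennreal (1 / c) * (\<Sum>n. ennreal (diameter (U n) powr s)) + (\<Sum>n. ennreal (e n))"
        by (simp only: suminf_add[symmetric, OF summableI summableI] ennreal_suminf_cmult)
      also have "(\<Sum>n. ennreal (e n)) = ennreal (1/2)"
      proof (rule suminf_ennreal_eq)
        have "(\<lambda>n. (1/4) * (1/2) ^ n) sums (1/4 * (1 / (1 - 1/2 :: real)))"
          by (intro sums_mult geometric_sums) simp
        then show "e sums (1/2)" by (simp add: e_def[abs_def] power_add field_simps)
      qed (simp add: e_def)
      also have "ennreal (1 / c) * (\<Sum>n. ennreal (diameter (U n) powr s)) + ennreal (1/2) < 1"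
      proof -
        have "ennreal (1 / c) * (\<Sum>n. ennreal (diameter (U n) powr s)) < ennreal (1 / c) * ennreal (c / 2)"
          using c small by (intro ennreal_mult_strict_left_mono) auto
        also have "\<dots> = ennreal (1/2)" using c by (simp add: ennreal_mult'[symmetric])
        finally have "ennreal (1 / c) * (\<Sum>n. ennreal (diameter (U n) powr s)) + ennreal (1/2)
            < ennreal (1/2) + ennreal (1/2)"
          by (subst (1 2) add.commute) (simp add: ennreal_add_left_cancel_less)
        also have "\<dots> = ennreal (1/2 + 1/2)" by (rule ennreal_plus[symmetric]) auto
        also have "\<dots> = 1" by (simp del: ennreal_plus)
        finally show ?thesis .
      qed
      finally obtain \<beta> where \<beta>: "\<And>i. \<beta> i \<in> I" "\<And>n. map \<beta> [0..<length (w n)] \<noteq> w n"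
        using sequence_avoiding_prefixes[OF finite_I ne] by blast
      then have "coding_map S \<beta> \<in> limit_set" by (auto simp: limit_set_def)
      then obtain n where "coding_map S \<beta> \<in> U n" using cover by auto
      with \<beta> w show False by metis
    qed
  qed simp
qed

lemma hausdorff_dim_limit_set_ge:
  assumes "I \<noteq> {}" "strong_separation I S limit_set"
    and \<rho>: "0 < \<rho>" "\<rho> < 1" "\<And>i. i \<in> I \<Longrightarrow> r i = \<rho>"
    and s: "1 \<le> card I * \<rho> powr s"
  shows "ereal s \<le> hausdorff_dim limit_set"
proof (rule hausdorff_dim_ge)
  fix t :: real assume t: "0 \<le> t" "t < s"
  show "hausdorff_measure t limit_set \<noteq> 0"
  proof (cases "t = 0")
    case True
    then show ?thesis
      using is_attractor_limit_set[OF assms(1)] by (simp add: is_attractor_def hausdorff_measure_0_nonzero)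
  next
    case False
    have "card I * \<rho> powr s \<le> card I * \<rho> powr t"
      using t \<rho> by (intro mult_left_mono powr_mono') auto
    then show ?thesis using False t s
      by (intro hausdorff_measure_limit_set_nonzero[OF assms(1,2) \<rho>]) auto
  qed
qed

end

section \<open>Covers by cylinders\<close>

context contracting_system begin

lemma bounded_comp_word_trap: "set w \<subseteq> I \<Longrightarrow> bounded (comp_word S w ` trap)"
  by (rule bounded_subset[OF bounded_cball[of 0 radius]]) (rule image_subsetI, rule comp_word_trap)

lemma diameter_comp_word_trap_le:
  assumes "set w \<subseteq> I"
  shows "diameter (comp_word S w ` trap) \<le> 2 * radius * ratio w"
proof (rule diameter_le)
  show "norm (x - y) \<le> 2 * radius * ratio w"
    if "x \<in> comp_word S w ` trap" "y \<in> comp_word S w ` trap" for x y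
    using that dist_comp_word_trap_le[OF assms] unfolding dist_norm by blast
qed (use ratio_pos[OF assms] radius_pos in simp)

text \<open>The \<open>card I ^ k\<close> cylinders of level \<open>k\<close> cover the limit set and have diameter at most a constant times
  \<open>max_ratio ^ k\<close>, so the measure vanishes once \<open>card I * max_ratio powr s < 1\<close>.\<close>
lemma hausdorff_dim_subset_limit_set_finite:
  assumes "F \<subseteq> limit_set"
  shows "hausdorff_dim F < \<infinity>"
proof -
  obtain n where n: "max_ratio ^ n < 1 / (card I + 1)"
    using real_arch_pow_inv[of "1 / (card I + 1)" max_ratio] max_ratio_less_1 by auto
  define s where "s = real n + 1"
  have s: "0 < s" by (simp add: s_def)
  define q where "q = card I * max_ratio powr s"
  have "max_ratio powr s \<le> max_ratio ^ n"
    using max_ratio_pos max_ratio_less_1 by (simp add: s_def powr_add powr_realpow)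
  with n have "max_ratio powr s < 1 / (card I + 1)" by linarith
  then have "max_ratio powr s + q < 1" by (simp add: q_def field_simps)
  moreover have "0 \<le> max_ratio powr s" "0 \<le> q" by (simp_all add: q_def)
  ultimately have q: "0 \<le> q" "q < 1" by linarith+
  have "hausdorff_measure s F = 0"
  proof (rule ccontr)
    assume "hausdorff_measure s F \<noteq> 0"
    then obtain c \<delta> where c: "0 < c" "0 < \<delta>" and card_ge:
      "\<And>(V :: nat list set) C d. finite V \<Longrightarrow> F \<subseteq> (\<Union>u\<in>V. C u) \<Longrightarrow> (\<And>u. u \<in> V \<Longrightarrow> bounded (C u)) \<Longrightarrow>
       (\<And>u. u \<in> V \<Longrightarrow> diameter (C u) \<le> d) \<Longrightarrow> 0 \<le> d \<Longrightarrow> d \<le> \<delta> \<Longrightarrow> c \<le> card V * d powr s"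
      using finite_cover_card_ge[where 'i = "nat list"] s by metis
    have "(\<lambda>k. q ^ k * (2 * radius) powr s) \<longlonglongrightarrow> 0"
      using q by (intro tendsto_mult_left_zero LIMSEQ_power_zero) auto
    then have "\<forall>\<^sub>F k in sequentially. q ^ k * (2 * radius) powr s < c"
      using c(1) by (rule order_tendstoD)
    moreover have "\<forall>\<^sub>F k in sequentially. 2 * radius * max_ratio ^ k < \<delta>"
      using tendsto_max_ratio_power c(2) by (rule order_tendstoD)
    ultimately have "\<forall>\<^sub>F k in sequentially. q ^ k * (2 * radius) powr s < c \<and> 2 * radius * max_ratio ^ k < \<delta>"
      by (rule eventually_conj)
    then obtain k where k: "q ^ k * (2 * radius) powr s < c" "2 * radius * max_ratio ^ k < \<delta>"
      by (auto simp: eventually_sequentially)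
    let ?V = "{w. set w \<subseteq> I \<and> length w = k}"
    have "c \<le> card ?V * (2 * radius * max_ratio ^ k) powr s"
    proof (rule card_ge)
      show "finite ?V" by (rule finite_lists_length_eq[OF finite_I])
      show "F \<subseteq> (\<Union>w\<in>?V. comp_word S w ` trap)"
      proof
        fix x assume "x \<in> F"
        then obtain \<alpha> where \<alpha>: "\<And>i. \<alpha> i \<in> I" "x = coding_map S \<alpha>" using assms by (auto simp: limit_set_def)
        then have "x \<in> comp_word S (map \<alpha> [0..<k]) ` trap"
          using coding_map_shift[of \<alpha> k] coding_map_trap[of "\<lambda>i. \<alpha> (i + k)"] by blast
        moreover have "map \<alpha> [0..<k] \<in> ?V" using \<alpha> by auto
        ultimately show "x \<in> (\<Union>w\<in>?V. comp_word S w ` trap)" by blast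
      qed
      show "bounded (comp_word S w ` trap)" if "w \<in> ?V" for w
        using that by (intro bounded_comp_word_trap) auto
      show "diameter (comp_word S w ` trap) \<le> 2 * radius * max_ratio ^ k" if "w \<in> ?V" for w
      proof -
        have "diameter (comp_word S w ` trap) \<le> 2 * radius * ratio w"
          using that by (intro diameter_comp_word_trap_le) auto
        also have "\<dots> \<le> 2 * radius * max_ratio ^ k"
          using ratio_le_max_ratio_power[of w] that radius_pos by simp
        finally show ?thesis .
      qed
    qed (use k radius_pos max_ratio_pos in auto)
    also have "\<dots> = q ^ k * (2 * radius) powr s"
      using radius_pos max_ratio_pos
      by (simp add: card_lists_length_eq finite_I q_def power_mult_distrib powr_mult powr_power
          powr_powr powr_realpow[symmetric] mult.commute)
    finally show False using k by simp
  qed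
  then have "hausdorff_dim F \<le> ereal s"
    unfolding hausdorff_dim_def using s by (intro Inf_lower) auto
  then show ?thesis by (rule order.strict_trans1) simp
qed

text \<open>The prefix at which the ratio first drops to \<open>max_ratio ^ k\<close>; its last letter costs at most the factor
  \<open>min_ratio\<close>. Since the ratio of a prefix of length \<open>n\<close> is at most \<open>max_ratio ^ n\<close>, this happens by
  time \<open>k\<close>, which bounds the length of stopped words linearly in \<open>k\<close>.\<close>
lemma stopping_time:
  assumes \<alpha>: "\<And>i. \<alpha> i \<in> I" and "0 < k"
  shows "\<exists>n. 0 < n \<and> n \<le> k \<and> min_ratio * max_ratio ^ k \<le> ratio (map \<alpha> [0..<n])
    \<and> ratio (map \<alpha> [0..<n]) \<le> max_ratio ^ k"
proof -
  let ?P = "\<lambda>n. ratio (map \<alpha> [0..<n]) \<le> max_ratio ^ k"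
  have "?P k" using ratio_le_max_ratio_power[of "map \<alpha> [0..<k]"] \<alpha> by auto
  define n where "n = (LEAST n. ?P n)"
  have n: "?P n" "n \<le> k" unfolding n_def using \<open>?P k\<close> by (rule LeastI, rule Least_le)
  have "max_ratio ^ k < 1"
    using \<open>0 < k\<close> max_ratio_pos max_ratio_less_1 by (simp add: power_less_one_iff)
  then have "n \<noteq> 0" using n(1) by (intro notI) simp
  then obtain n' where n': "n = Suc n'" using not0_implies_Suc by blast
  have "max_ratio ^ k < ratio (map \<alpha> [0..<n'])"
    using not_less_Least[of n' ?P] n' by (simp add: n_def)
  then have "min_ratio * max_ratio ^ k \<le> r (\<alpha> n') * ratio (map \<alpha> [0..<n'])"
    using min_ratio_pos max_ratio_pos \<alpha> by (intro mult_mono min_ratio_le_r) (auto intro: less_imp_le[OF r_pos])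
  then show ?thesis using n n' \<open>n \<noteq> 0\<close> by (intro exI[of _ n]) (simp add: mult.commute)
qed

end

section \<open>Loops of an irreducible subshift\<close>

definition transition :: "nat mat \<Rightarrow> nat \<Rightarrow> nat \<Rightarrow> bool" where
  "transition A a b \<longleftrightarrow> A $$ (a, b) = 1"

text \<open>The entries of \<open>A ^\<^sub>m n\<close> count paths. The word of a path omits its final vertex \<open>j\<close>, so that paths
  compose by concatenation.\<close>
lemma path_of_matrix_power:
  assumes A: "zero_one_matrix M A" and i: "i < M" and "j < M" "0 < (A ^\<^sub>m n) $$ (i, j)"
  shows "\<exists>w. length w = n \<and> set w \<subseteq> {..<M} \<and> hd (w @ [j]) = i \<and> successively (transition A) (w @ [j])"
  using assms(3,4)
proof (induction n arbitrary: j)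
  case 0
  then have "i = j" using A i by (auto simp: zero_one_matrix_def split: if_splits)
  then show ?case by simp
next
  case (Suc n)
  have A': "A \<in> carrier_mat M M" using A by (simp add: zero_one_matrix_def)
  then have "(A ^\<^sub>m Suc n) $$ (i, j) = (\<Sum>k = 0..<M. (A ^\<^sub>m n) $$ (i, k) * A $$ (k, j))"
    using i Suc.prems(1) pow_carrier_mat[OF A', of n] by (simp add: scalar_prod_def)
  then have "(\<Sum>k = 0..<M. (A ^\<^sub>m n) $$ (i, k) * A $$ (k, j)) \<noteq> 0" using Suc.prems(2) by linarith
  then obtain k where k: "k < M" "(A ^\<^sub>m n) $$ (i, k) * A $$ (k, j) \<noteq> 0"
    by (rule sum.not_neutral_contains_not_neutral) auto
  moreover have "A $$ (k, j) \<in> {0, 1}"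
    using A k(1) Suc.prems(1) unfolding zero_one_matrix_def by blast
  ultimately have "transition A k j" "0 < (A ^\<^sub>m n) $$ (i, k)"
    by (auto simp: transition_def)
  with Suc.IH[OF k(1)] obtain w where "length w = n" "set w \<subseteq> {..<M}" "hd (w @ [k]) = i"
    "successively (transition A) (w @ [k])" by auto
  with k \<open>transition A k j\<close> show ?case
    by (intro exI[of _ "w @ [k]"]) (auto simp: successively_append_iff hd_append)
qed

lemma irreducible_path:
  assumes "zero_one_matrix M A" "irreducible_subshift M A" "i < M" "j < M"
  shows "\<exists>w. w \<noteq> [] \<and> set w \<subseteq> {..<M} \<and> hd w = i \<and> successively (transition A) (w @ [j])"
proof -
  obtain n where n: "0 < n" "0 < (A ^\<^sub>m n) $$ (i, j)"
    using assms(2-4) unfolding irreducible_subshift_def by blast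
  obtain w where w: "length w = n" "set w \<subseteq> {..<M}" "hd (w @ [j]) = i" "successively (transition A) (w @ [j])"
    using path_of_matrix_power[OF assms(1,3,4) n(2)] by blast
  then have "w \<noteq> []" using n(1) by auto
  then show ?thesis using w by (intro exI[of _ w]) (simp add: hd_append)
qed

lemma loop_words_iff:
  "w \<in> loop_words M A j \<longleftrightarrow>
     w \<noteq> [] \<and> set w \<subseteq> {..<M} \<and> hd w = j \<and> successively (transition A) (w @ [j])"
proof -
  have "successively (transition A) (w @ [j]) \<longleftrightarrow>
      successively (transition A) w \<and> (w = [] \<or> transition A (last w) j)"
    by (auto simp: successively_append_iff)
  then show ?thesis
    unfolding loop_words_def successively_conv_nth[of _ w] by (auto simp: transition_def)
qed

lemma loop_words_append:
  assumes "u \<in> loop_words M A j" "w \<in> loop_words M A j"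
  shows "u @ w \<in> loop_words M A j"
  using assms by (auto simp: loop_words_iff successively_append_iff)

lemma subshift_transition: "\<alpha> \<in> subshift M A \<longleftrightarrow> (\<forall>i. \<alpha> i < M) \<and> (\<forall>i. transition A (\<alpha> i) (\<alpha> (Suc i)))"
  by (simp add: subshift_def transition_def)

definition prepend_word :: "'i list \<Rightarrow> (nat \<Rightarrow> 'i) \<Rightarrow> nat \<Rightarrow> 'i" where
  "prepend_word w \<alpha> n = (if n < length w then w ! n else \<alpha> (n - length w))"

lemma prepend_word_in_subshift:
  assumes w: "w \<in> loop_words M A j" and \<alpha>: "\<alpha> \<in> subshift M A" "\<alpha> 0 = j"
  shows "prepend_word w \<alpha> \<in> subshift M A" "prepend_word w \<alpha> 0 = j"
proof -
  have w': "w \<noteq> []" "set w \<subseteq> {..<M}" "hd w = j" "successively (transition A) (w @ [j])"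
    using w by (auto simp: loop_words_iff)
  show "prepend_word w \<alpha> 0 = j" using w' by (simp add: prepend_word_def hd_conv_nth)
  have "transition A (prepend_word w \<alpha> n) (prepend_word w \<alpha> (Suc n))" for n
  proof (cases "n < length w")
    case True
    then have "transition A ((w @ [j]) ! n) ((w @ [j]) ! Suc n)"
      using successively_nth[OF w'(4), of n] by simp
    with True show ?thesis
      by (cases "Suc n < length w")
        (auto simp: prepend_word_def nth_append \<alpha>(2) less_Suc_eq not_less le_Suc_eq)
  next
    case False
    then show ?thesis using \<alpha>(1) by (simp add: prepend_word_def subshift_transition Suc_diff_le)
  qed
  moreover have "prepend_word w \<alpha> n < M" for n
    using subsetD[OF w'(2) nth_mem[of n]] \<alpha>(1) by (auto simp: prepend_word_def subshift_transition)
  ultimately show "prepend_word w \<alpha> \<in> subshift M A" by (simp add: subshift_transition)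
qed

lemma periodic_in_subshift:
  assumes w: "w \<in> loop_words M A j"
  shows "(\<lambda>n. w ! (n mod length w)) \<in> subshift M A"
proof -
  have w': "w \<noteq> []" "set w \<subseteq> {..<M}" "hd w = j" "successively (transition A) (w @ [j])"
    using w by (auto simp: loop_words_iff)
  have "transition A (w ! (n mod length w)) (w ! (Suc n mod length w))" for n
  proof -
    have less: "n mod length w < length w" using w'(1) by simp
    then have "transition A ((w @ [j]) ! (n mod length w)) ((w @ [j]) ! Suc (n mod length w))"
      using successively_nth[OF w'(4), of "n mod length w"] by simp
    moreover have "Suc (n mod length w) < length w \<or> Suc (n mod length w) = length w" using less by linarith
    ultimately show ?thesis using less w'(1,3) by (auto simp: mod_Suc nth_append hd_conv_nth)
  qed
  then show ?thesis using w'(1,2) nth_mem[of "_ mod length w" w]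
    by (force simp: subshift_transition)
qed

text \<open>The alphabet is discrete, so conditions on finitely many coordinates are closed.\<close>
lemma closed_coordinate_relation:
  "closed {\<alpha> :: nat \<Rightarrow> nat. P (\<alpha> i) (\<alpha> k)}"
proof -
  have vimage: "closed {\<alpha> :: nat \<Rightarrow> nat. \<alpha> i \<in> X}" for i X
    using closed_vimage[OF _ continuous_on_product_coordinates, of X i]
    by (simp add: vimage_def closed_def open_discrete)
  have "closed (\<Inter>a. {\<alpha> :: nat \<Rightarrow> nat. \<alpha> i \<in> - {a}} \<union> {\<alpha>. \<alpha> k \<in> {b. P a b}})"
    by (intro closed_INT closed_Un ballI vimage)
  also have "\<dots> = {\<alpha>. P (\<alpha> i) (\<alpha> k)}" by auto
  finally show ?thesis .
qed

lemma closed_subshift_part: "closed {\<alpha> \<in> subshift M A. \<alpha> 0 = j}"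
proof -
  have "closed ({\<alpha>. \<alpha> 0 = j} \<inter>
      (\<Inter>i. {\<alpha>. (\<lambda>a b. a < M \<and> transition A a b) (\<alpha> i) (\<alpha> (Suc i))}))"
    by (intro closed_Int closed_INT ballI closed_coordinate_relation[of "\<lambda>a b. a = j" 0 0]
        closed_coordinate_relation)
  also have "\<dots> = {\<alpha> \<in> subshift M A. \<alpha> 0 = j}" by (auto simp: subshift_transition)
  finally show ?thesis .
qed

locale irreducible_system = contracting_system "{..<M}" r T v
  for M :: nat and r :: "nat \<Rightarrow> real" and T :: "nat \<Rightarrow> 'a \<Rightarrow> 'a::euclidean_space" and v :: "nat \<Rightarrow> 'a" +
  fixes A :: "nat mat" and j :: nat
  assumes zero_one: "zero_one_matrix M A"
    and irreducible: "irreducible_subshift M A"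
    and j_less: "j < M"
begin

lemma exists_path:
  "i < M \<Longrightarrow> k < M \<Longrightarrow>
    \<exists>w. w \<noteq> [] \<and> set w \<subseteq> {..<M} \<and> hd w = i \<and> successively (transition A) (w @ [k])"
  by (rule irreducible_path[OF zero_one irreducible])

lemma loop_words_nonempty: "loop_words M A j \<noteq> {}"
  using exists_path[OF j_less j_less] by (auto simp: loop_words_iff)

lemma loop_word_set: "w \<in> loop_words M A j \<Longrightarrow> set w \<subseteq> {..<M}"
  by (simp add: loop_words_iff)

lemma F_part_subset_F_set: "F_part M A S i \<subseteq> F_set M A S"
  by (auto simp: F_part_def F_set_def)

lemma F_set_subset_limit_set: "F_set M A S \<subseteq> limit_set"
  by (auto simp: F_set_def limit_set_def subshift_transition)

lemma F_part_nonempty: "F_part M A S j \<noteq> {}"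
proof -
  obtain w where w: "w \<in> loop_words M A j" using loop_words_nonempty by auto
  then have "w ! 0 = j" by (auto simp: loop_words_iff hd_conv_nth)
  then show ?thesis using periodic_in_subshift[OF w] by (auto simp: F_part_def)
qed

lemma compact_F_part: "compact (F_part M A S i)"
  unfolding F_part_def
  by (intro compact_coding_map_image closed_subshift_part) (auto simp: subshift_transition)

lemma F_part_loop_invariant:
  assumes "w \<in> loop_words M A j"
  shows "comp_word S w ` F_part M A S j \<subseteq> F_part M A S j"
proof
  fix x assume "x \<in> comp_word S w ` F_part M A S j"
  then obtain \<alpha> where \<alpha>: "\<alpha> \<in> subshift M A" "\<alpha> 0 = j" "x = comp_word S w (coding_map S \<alpha>)"
    by (auto simp: F_part_def)
  note pre = prepend_word_in_subshift[OF assms \<alpha>(1,2)]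
  have "map (prepend_word w \<alpha>) [0..<length w] = w"
    by (rule nth_equalityI) (auto simp: prepend_word_def)
  moreover have "(\<lambda>i. prepend_word w \<alpha> (i + length w)) = \<alpha>" by (auto simp: prepend_word_def)
  ultimately have "x = coding_map S (prepend_word w \<alpha>)"
    using coding_map_shift[of "prepend_word w \<alpha>" "length w"] pre(1) \<alpha>(3)
    by (auto simp: subshift_transition)
  then show "x \<in> F_part M A S j" using pre by (auto simp: F_part_def)
qed

lemma finite_loop_transformations:
  assumes "finite (transformation_group M A T j)"
  shows "finite (comp_word T ` loop_words M A j)"
  using assms
  by (rule finite_subset[rotated]) (auto simp: transformation_group_def intro: generate.incl)

text \<open>The orthogonal parts of loops form a finite set \<open>X\<close> closed under composition. Composing with a fixed
  \<open>g \<in> X\<close> is injective on \<open>X\<close>, hence onto, so every equation \<open>g \<circ> h = Q\<close> with \<open>Q \<in> X\<close> is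
  solvable in \<open>X\<close>. In particular \<open>X\<close> contains the identity and inverses, and equals the group it
  generates.\<close>
lemma transformation_group_solve:
  assumes fin: "finite (transformation_group M A T j)"
    and g: "g \<in> comp_word T ` loop_words M A j" and Q: "Q \<in> transformation_group M A T j"
  shows "\<exists>w\<in>loop_words M A j. g \<circ> comp_word T w = Q"
proof -
  let ?X = "comp_word T ` loop_words M A j"
  have finX: "finite ?X" by (rule finite_loop_transformations[OF fin])
  have closed: "g \<circ> h \<in> ?X" if "g \<in> ?X" "h \<in> ?X" for g h
    using that loop_words_append by (force simp: comp_word_append[symmetric])
  have orth: "orthogonal_transformation g" if "g \<in> ?X" for g
    using that T_comp_orthogonal loop_word_set by blast
  have cancel: "a = b" if "g \<in> ?X" "g \<circ> a = g \<circ> b" for g a b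
  proof
    fix x
    have "g (a x) = g (b x)" using fun_cong[OF that(2), of x] by simp
    then show "a x = b x" using orthogonal_transformation_inj[OF orth[OF that(1)]] by (simp add: inj_eq)
  qed
  have solve: "\<exists>h\<in>?X. g \<circ> h = Q" if "g \<in> ?X" "Q \<in> ?X" for g Q
  proof -
    have "inj_on (\<lambda>h. g \<circ> h) ?X"
      using cancel[OF that(1)] by (rule inj_onI)
    then have "(\<lambda>h. g \<circ> h) ` ?X = ?X"
      using closed[OF that(1)] by (intro endo_inj_surj finX) auto
    then show ?thesis using that(2) by (metis (no_types, lifting) imageE)
  qed
  have id_in: "id \<in> ?X"
  proof -
    obtain g where g: "g \<in> ?X" using loop_words_nonempty by auto
    obtain h where h: "h \<in> ?X" "g \<circ> h = g" using solve[OF g g] by auto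
    then have "h = id"
      using cancel[OF g, of h id] by simp
    then show ?thesis using h by simp
  qed
  have "Q \<in> ?X"
    using Q unfolding transformation_group_def
  proof (induction rule: generate.induct)
    case one
    have "\<one>\<^bsub>orthogonal_group\<^esub> = (id :: 'a \<Rightarrow> 'a)" by (simp only: orthogonal_group_def monoid.simps)
    then show ?case using id_in by (simp only:)
  next
    \<comment> \<open>The solution \<open>k\<close> of \<open>h \<circ> k = id\<close> in \<open>X\<close> is the inverse of \<open>h\<close>.\<close>
    case (inv h)
    obtain k where k: "k \<in> ?X" "h \<circ> k = id" using solve[OF inv id_in] by auto
    have "inv\<^bsub>orthogonal_group\<^esub> k = h"
      using k orth[OF k(1)] orth[OF inv]
      by (intro group.inv_equality[OF group_orthogonal_group]) (auto simp: orthogonal_group_def)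
    then have "inv\<^bsub>orthogonal_group\<^esub> h = k"
      using group.inv_inv[OF group_orthogonal_group, of k] orth[OF k(1)]
      by (simp add: orthogonal_group_def)
    then show ?case using k by simp
  next
    case (eng h1 h2)
    have "h1 \<otimes>\<^bsub>orthogonal_group\<^esub> h2 = h1 \<circ> h2" by (simp only: orthogonal_group_def monoid.simps)
    then show ?case using closed[OF eng.IH] by (simp only:)
  qed
  then show ?thesis using solve[OF g] by auto
qed

text \<open>The head \<open>p\<close> depends only on the first letter of \<open>u\<close>: prefixing the same word to all \<open>u\<close> with a given
  first letter applies one injective map to their cylinders and keeps them disjoint. The tail \<open>q u\<close> leads
  from the last letter of \<open>u\<close> back to \<open>j\<close> by a path \<open>c\<close> and then follows a loop \<open>h\<close> that corrects the
  orthogonal part.\<close>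
lemma loop_completion:
  assumes fin: "finite (transformation_group M A T j)" and Q: "Q \<in> transformation_group M A T j"
  shows "\<exists>p q L. \<forall>u. u \<noteq> [] \<and> set u \<subseteq> {..<M} \<and> successively (transition A) u \<longrightarrow>
      p (hd u) @ u @ q u \<in> loop_words M A j \<and> comp_word T (p (hd u) @ u @ q u) = Q \<and>
      length (p (hd u)) + length (q u) \<le> L"
proof -
  let ?X = "comp_word T ` loop_words M A j"
  have finX: "finite ?X" by (rule finite_loop_transformations[OF fin])
  have "\<forall>i\<in>{..<M}. \<exists>w. w \<noteq> [] \<and> set w \<subseteq> {..<M} \<and> hd w = j \<and> successively (transition A) (w @ [i])"
    using exists_path j_less by auto
  then obtain p where p: "\<forall>i\<in>{..<M}. p i \<noteq> [] \<and> set (p i) \<subseteq> {..<M} \<and> hd (p i) = j \<and>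
      successively (transition A) (p i @ [i])"
    by (rule bchoice[THEN exE])
  have "\<forall>i\<in>{..<M}. \<exists>c. set c \<subseteq> {..<M} \<and> successively (transition A) (i # c @ [j])"
  proof
    fix i assume "i \<in> {..<M}"
    then obtain w where "w \<noteq> []" "set w \<subseteq> {..<M}" "hd w = i" "successively (transition A) (w @ [j])"
      using exists_path[of i j] j_less by auto
    then show "\<exists>c. set c \<subseteq> {..<M} \<and> successively (transition A) (i # c @ [j])"
      by (cases w) auto
  qed
  then obtain c where c: "\<forall>i\<in>{..<M}. set (c i) \<subseteq> {..<M} \<and> successively (transition A) (i # c i @ [j])"
    by (rule bchoice[THEN exE])
  have "\<forall>g\<in>?X. \<exists>w. w \<in> loop_words M A j \<and> g \<circ> comp_word T w = Q"
    using transformation_group_solve[OF fin _ Q] by blast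
  then obtain h where h: "\<forall>g\<in>?X. h g \<in> loop_words M A j \<and> g \<circ> comp_word T (h g) = Q"
    by (rule bchoice[THEN exE])
  define q where "q u = c (last u) @ h (comp_word T (p (hd u) @ u @ c (last u)))" for u
  define L where "L = (\<Sum>i<M. length (p i)) + (\<Sum>i<M. length (c i)) + (\<Sum>g\<in>?X. length (h g))"
  have "p (hd u) @ u @ q u \<in> loop_words M A j \<and> comp_word T (p (hd u) @ u @ q u) = Q \<and>
      length (p (hd u)) + length (q u) \<le> L"
    if u: "u \<noteq> []" "set u \<subseteq> {..<M}" "successively (transition A) u" for u
  proof -
    have hd_last: "hd u \<in> {..<M}" "last u \<in> {..<M}"
      using u(1,2) hd_in_set[of u] last_in_set[of u] by blast+
    note pu = bspec[OF p hd_last(1)] and cu = bspec[OF c hd_last(2)]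
    let ?w = "p (hd u) @ u @ c (last u)"
    have w: "?w \<in> loop_words M A j"
      using u pu cu by (auto simp: loop_words_iff successively_append_iff successively_Cons hd_append)
    then have g: "comp_word T ?w \<in> ?X" by simp
    note hg = bspec[OF h g]
    have eq: "p (hd u) @ u @ q u = ?w @ h (comp_word T ?w)" by (simp add: q_def)
    have "p (hd u) @ u @ q u \<in> loop_words M A j"
      unfolding eq by (rule loop_words_append[OF w]) (use hg in blast)
    moreover have "comp_word T (p (hd u) @ u @ q u) = Q"
      unfolding eq using hg by (simp only: comp_word_append[of T ?w])
    moreover have "length (p (hd u)) + length (q u) \<le> L"
    proof -
      have "length (p (hd u)) \<le> (\<Sum>i<M. length (p i))"
        using hd_last(1) by (intro member_le_sum) auto
      moreover have "length (c (last u)) \<le> (\<Sum>i<M. length (c i))"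
        using hd_last(2) by (intro member_le_sum) auto
      moreover have "length (h (comp_word T ?w)) \<le> (\<Sum>g\<in>?X. length (h g))"
        using g finX by (intro member_le_sum) auto
      ultimately show ?thesis by (simp add: L_def q_def)
    qed
    ultimately show ?thesis by blast
  qed
  then show ?thesis by blast
qed

lemma loop_word_ratio:
  assumes "w \<in> loop_words M A j"
  shows "0 < ratio w" "ratio w < 1"
proof -
  have I: "set w \<subseteq> {..<M}" and "w \<noteq> []" using assms by (auto simp: loop_words_iff)
  then have "max_ratio ^ length w < 1"
    using max_ratio_pos max_ratio_less_1 by (simp add: power_less_one_iff)
  then show "0 < ratio w" "ratio w < 1"
    using ratio_pos[OF I] ratio_le_max_ratio_power[OF I] by auto
qed

end

section \<open>Systems of loops with equal ratio and equal orthogonal part\<close>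

context irreducible_system begin

text \<open>Equal ratios and orthogonal parts make the maps of the loops differ by translations only. Their attractor
  lies in \<open>F_part M A S j\<close>, which is closed and invariant under loops, and in particular in the
  trap, so disjointness of the images of the trap gives strong separation.\<close>
lemma uniform_subsystem:
  assumes fin: "finite V" "V \<noteq> {}"
    and W: "\<And>u. u \<in> V \<Longrightarrow> W u \<in> loop_words M A j" "\<And>u. u \<in> V \<Longrightarrow> comp_word T (W u) = Q"
      "\<And>u. u \<in> V \<Longrightarrow> ratio (W u) = \<rho>"
    and disj: "disjoint_family_on (\<lambda>u. comp_word S (W u) ` trap) V"
    and s: "1 \<le> card V * \<rho> powr s"
  shows "\<exists>m r' T' v' K. 0 < \<rho> \<and> \<rho> < 1 \<and>
      contracting_similarities {1..m::nat} r' T' \<and>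
      is_attractor {1..m} (sim r' T' v') K \<and>
      strong_separation {1..m} (sim r' T' v') K \<and>
      K \<subseteq> F_part M A S j \<and> ereal s \<le> hausdorff_dim K \<and>
      (\<forall>i\<in>{1..m}. T' i = Q \<and> r' i = \<rho>)"
proof -
  define m where "m = card V"
  obtain h where h: "bij_betw h {1..m} V" unfolding m_def using ex_bij_betw_nat_finite_1[OF fin(1)] by auto
  have hV: "h i \<in> V" if "i \<in> {1..m}" for i using h that by (auto simp: bij_betw_def)
  have m: "m \<noteq> 0" using fin by (simp add: m_def)
  have \<rho>: "0 < \<rho>" "\<rho> < 1" using fin(2) W(1,3) loop_word_ratio by blast+
  have Q: "orthogonal_transformation Q"
    using fin(2) W(1,2) T_comp_orthogonal loop_word_set by blast
  define r' :: "nat \<Rightarrow> real" where "r' = (\<lambda>_. \<rho>)"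
  define T' :: "nat \<Rightarrow> 'a \<Rightarrow> 'a" where "T' = (\<lambda>_. Q)"
  define v' where "v' i = comp_word S (W (h i)) 0" for i
  interpret sub: contracting_system "{1..m}" r' T' v'
    by unfold_locales (simp add: contracting_similarities_def r'_def T'_def \<rho> Q)
  have sub_S: "sub.S i = comp_word S (W (h i))" if "i \<in> {1..m}" for i
  proof
    fix x
    show "sub.S i x = comp_word S (W (h i)) x"
      unfolding comp_word_sim[OF loop_word_set[OF W(1)[OF hV[OF that]]], of x]
        W(2,3)[OF hV[OF that]] sim_def[of r' T' v' i x] by (simp add: r'_def T'_def v'_def)
  qed
  have sub: "sub.limit_set \<subseteq> F_part M A S j"
  proof (rule sub.limit_set_subset_closed)
    show "closed (F_part M A S j)" by (rule compact_imp_closed[OF compact_F_part])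
    show "sub.S i ` F_part M A S j \<subseteq> F_part M A S j" if "i \<in> {1..m}" for i
      unfolding sub_S[OF that] by (rule F_part_loop_invariant[OF W(1)[OF hV[OF that]]])
  qed (rule F_part_nonempty)
  then have trap: "sub.limit_set \<subseteq> trap"
    using F_part_subset_F_set F_set_subset_limit_set limit_set_subset_trap by blast
  have ssc: "strong_separation {1..m} sub.S sub.limit_set"
    unfolding strong_separation_def disjoint_family_on_def
  proof (intro ballI impI)
    fix i k assume ik: "i \<in> {1..m}" "k \<in> {1..m}" "i \<noteq> k"
    then have "h i \<noteq> h k" using inj_on_eq_iff[OF bij_betw_imp_inj_on[OF h]] by blast
    then have "comp_word S (W (h i)) ` trap \<inter> comp_word S (W (h k)) ` trap = {}"
      using disj hV ik by (auto simp: disjoint_family_on_def simp del: mem_cball)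
    then show "sub.S i ` sub.limit_set \<inter> sub.S k ` sub.limit_set = {}"
      unfolding sub_S[OF ik(1)] sub_S[OF ik(2)] using trap by blast
  qed
  have "ereal s \<le> hausdorff_dim sub.limit_set"
    using m s \<rho> ssc by (intro sub.hausdorff_dim_limit_set_ge[of \<rho>]) (auto simp: r'_def m_def)
  moreover have "is_attractor {1..m} sub.S sub.limit_set"
    using m by (intro sub.is_attractor_limit_set) auto
  ultimately show ?thesis
    using \<rho> sub ssc sub.contracting
    by (intro exI[of _ m] exI[of _ r'] exI[of _ T'] exI[of _ v'] exI[of _ sub.limit_set])
      (auto simp: r'_def T'_def)
qed

end

section \<open>Counting disjoint cylinders\<close>

lemma finite_maximal_disjoint_subfamily:
  assumes "finite V" "\<And>u. u \<in> V \<Longrightarrow> P u \<noteq> {}"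
  shows "\<exists>U\<subseteq>V. disjoint_family_on P U \<and> (\<forall>u\<in>V. \<exists>u'\<in>U. P u \<inter> P u' \<noteq> {})"
  using assms
proof (induction V rule: finite_induct)
  case (insert x V)
  then obtain U where U: "U \<subseteq> V" "disjoint_family_on P U" "\<forall>u\<in>V. \<exists>u'\<in>U. P u \<inter> P u' \<noteq> {}"
    by auto
  show ?case
  proof (cases "\<exists>u'\<in>U. P x \<inter> P u' \<noteq> {}")
    case True
    with U show ?thesis by (intro exI[of _ U]) auto
  next
    case False
    then have "disjoint_family_on P (insert x U)"
      using U(2) by (auto simp: disjoint_family_on_def)
    moreover have "\<forall>u\<in>insert x V. \<exists>u'\<in>insert x U. P u \<inter> P u' \<noteq> {}"
      using U(3) insert.prems by auto
    ultimately show ?thesis using U(1) by (intro exI[of _ "insert x U"]) auto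
  qed
qed (simp add: disjoint_family_on_def)

text \<open>With \<open>\<phi>\<close> the \<open>m\<close>-th root of \<open>\<theta>\<close> the expression is the \<open>m\<close>-th power of \<open>real (k + b) * \<phi> ^ k\<close>.\<close>
lemma polynomial_times_geometric_tendsto_0:
  fixes \<theta> :: real
  assumes "0 < \<theta>" "\<theta> < 1" "0 < m"
  shows "(\<lambda>k. real (k + b) ^ m * \<theta> ^ k) \<longlonglongrightarrow> 0"
proof -
  define \<phi> where "\<phi> = root m \<theta>"
  have \<phi>: "0 < \<phi>" "\<phi> < 1" "\<phi> ^ m = \<theta>" using assms by (auto simp: \<phi>_def)
  have "(\<lambda>k. real k * \<phi> ^ k + real b * \<phi> ^ k) \<longlonglongrightarrow> 0 + real b * 0"
    using \<phi> by (intro tendsto_intros powser_times_n_limit_0 LIMSEQ_power_zero) auto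
  then have "(\<lambda>k. (real (k + b) * \<phi> ^ k) ^ m) \<longlonglongrightarrow> 0 ^ m"
    by (intro tendsto_power) (simp add: algebra_simps)
  moreover have "(real (k + b) * \<phi> ^ k) ^ m = real (k + b) ^ m * \<theta> ^ k" for k
    by (simp add: power_mult_distrib \<phi>(3)[symmetric] power_mult[symmetric] mult.commute)
  ultimately have "(\<lambda>k. real (k + b) ^ m * \<theta> ^ k) \<longlonglongrightarrow> 0 ^ m" by (simp only:)
  also have "(0 :: real) ^ m = 0" using assms(3) by simp
  finally show ?thesis .
qed

lemma prod_list_eq_prod_count:
  fixes f :: "'i \<Rightarrow> 'b::comm_monoid_mult"
  assumes "finite I" "set w \<subseteq> I"
  shows "prod_list (map f w) = (\<Prod>i\<in>I. f i ^ count_list w i)"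
  using assms(2)
proof (induction w)
  case (Cons a w)
  have "f i ^ count_list (a # w) i = (if i = a then f i else 1) * f i ^ count_list w i" for i by simp
  then have "(\<Prod>i\<in>I. f i ^ count_list (a # w) i)
      = (\<Prod>i\<in>I. if i = a then f i else 1) * (\<Prod>i\<in>I. f i ^ count_list w i)"
    by (simp only: prod.distrib)
  also have "(\<Prod>i\<in>I. if i = a then f i else 1) = f a" using assms(1) Cons.prems by simp
  finally show ?case using Cons by simp
qed simp

text \<open>A product over a word depends only on the number of occurrences of each letter.\<close>
lemma card_prod_list_image_le:
  fixes f :: "'i \<Rightarrow> 'b::comm_monoid_mult"
  assumes "finite I"
  shows "finite ((\<lambda>w. prod_list (map f w)) ` {w. set w \<subseteq> I \<and> length w \<le> n})" (is "finite ?P")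
    and "card ((\<lambda>w. prod_list (map f w)) ` {w. set w \<subseteq> I \<and> length w \<le> n}) \<le> (n + 1) ^ card I"
proof -
  let ?C = "PiE I (\<lambda>_. {..n})" and ?g = "\<lambda>c. \<Prod>i\<in>I. f i ^ c i"
  have fin: "finite ?C" using assms by (intro finite_PiE) auto
  have sub: "?P \<subseteq> ?g ` ?C"
  proof (clarify)
    fix w assume w: "set w \<subseteq> I" "length w \<le> n"
    have "prod_list (map f w) = ?g (restrict (count_list w) I)"
      by (simp add: prod_list_eq_prod_count[OF assms w(1)])
    moreover have "restrict (count_list w) I \<in> ?C"
      using w(2) count_le_length[of w] by (auto intro: order_trans)
    ultimately show "prod_list (map f w) \<in> ?g ` ?C" by blast
  qed
  show "finite ?P" using finite_subset[OF sub] fin by auto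
  have "card ?P \<le> card (?g ` ?C)" using sub fin by (intro card_mono) auto
  also have "\<dots> \<le> card ?C" by (rule card_image_le[OF fin])
  also have "\<dots> = (n + 1) ^ card I" using assms by (simp add: card_PiE)
  finally show "card ?P \<le> (n + 1) ^ card I" .
qed

context irreducible_system begin

text \<open>Every stopped cylinder meets a member of a maximal disjoint family, and both have diameter at most
  \<open>2 * radius * max_ratio ^ k\<close>; the distance to the centre of the member is therefore at most
  \<open>(2 + 1) * radius * max_ratio ^ k\<close>.\<close>
lemma disjoint_words_cover:
  assumes "0 < k"
  shows "\<exists>V. finite V \<and>
    (\<forall>u\<in>V. u \<noteq> [] \<and> set u \<subseteq> {..<M} \<and> successively (transition A) u \<and> length u \<le> k \<and>
       min_ratio * max_ratio ^ k \<le> ratio u) \<and>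
    disjoint_family_on (\<lambda>u. comp_word S u ` trap) V \<and>
    F_set M A S \<subseteq> (\<Union>u\<in>V. cball (comp_word S u 0) (3 * radius * max_ratio ^ k))"
proof -
  let ?V = "{u. set u \<subseteq> {..<M} \<and> length u \<le> k \<and> u \<noteq> [] \<and> successively (transition A) u \<and>
      min_ratio * max_ratio ^ k \<le> ratio u \<and> ratio u \<le> max_ratio ^ k}"
  have "finite ?V" by (rule finite_subset[OF _ finite_lists_length_le[of "{..<M}" k]]) auto
  moreover have "comp_word S u ` trap \<noteq> {}" for u using radius_pos by auto
  ultimately have "\<exists>V\<subseteq>?V. disjoint_family_on (\<lambda>u. comp_word S u ` trap) V \<and>
      (\<forall>u\<in>?V. \<exists>u'\<in>V. comp_word S u ` trap \<inter> comp_word S u' ` trap \<noteq> {})"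
    by (rule finite_maximal_disjoint_subfamily)
  then obtain V where V: "V \<subseteq> ?V" "disjoint_family_on (\<lambda>u. comp_word S u ` trap) V"
    and max: "\<forall>u\<in>?V. \<exists>u'\<in>V. comp_word S u ` trap \<inter> comp_word S u' ` trap \<noteq> {}"
    by (elim exE conjE)
  have "x \<in> (\<Union>u\<in>V. cball (comp_word S u 0) (3 * radius * max_ratio ^ k))" if x: "x \<in> F_set M A S" for x
  proof -
    obtain \<alpha> where \<alpha>: "\<alpha> \<in> subshift M A" "x = coding_map S \<alpha>" using x by (auto simp: F_set_def)
    then have I: "\<And>i. \<alpha> i \<in> {..<M}" by (simp add: subshift_transition)
    obtain n where n: "0 < n" "n \<le> k" "min_ratio * max_ratio ^ k \<le> ratio (map \<alpha> [0..<n])"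
      "ratio (map \<alpha> [0..<n]) \<le> max_ratio ^ k"
      using stopping_time[of \<alpha>, OF I assms] by (elim exE conjE)
    let ?u = "map \<alpha> [0..<n]"
    have "successively (transition A) ?u"
      using \<alpha> by (auto simp: successively_conv_nth subshift_transition)
    then have "?u \<in> ?V" using n I by auto
    then obtain u' y where u': "u' \<in> V" "y \<in> comp_word S ?u ` trap" "y \<in> comp_word S u' ` trap"
      using max by blast
    then have u'V: "set u' \<subseteq> {..<M}" "ratio u' \<le> max_ratio ^ k" using V(1) by auto
    have "set ?u \<subseteq> {..<M}" using I by auto
    moreover have "x = comp_word S ?u (coding_map S (\<lambda>i. \<alpha> (i + n)))"
      unfolding \<alpha>(2) by (rule coding_map_shift[OF I])
    moreover have "coding_map S (\<lambda>i. \<alpha> (i + n)) \<in> trap" by (rule coding_map_trap[OF I])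
    ultimately have "dist x y \<le> 2 * radius * ratio ?u"
      using u'(2) dist_comp_word_trap_le[of ?u] by blast
    also have "\<dots> \<le> 2 * radius * max_ratio ^ k" using n(4) radius_pos by simp
    finally have xy: "dist x y \<le> 2 * radius * max_ratio ^ k" .
    obtain z where z: "y = comp_word S u' z" "z \<in> trap" using u'(3) by blast
    have "dist (comp_word S u' 0) y = ratio u' * norm z"
      unfolding z(1) dist_comp_word[OF u'V(1)] by simp
    also have "\<dots> \<le> max_ratio ^ k * radius"
      using u'V z(2) ratio_pos[OF u'V(1)] by (intro mult_mono) auto
    finally have "dist (comp_word S u' 0) x \<le> 3 * radius * max_ratio ^ k"
      using xy dist_triangle[of "comp_word S u' 0" x y] by (simp add: dist_commute algebra_simps)
    then show ?thesis using u'(1) by auto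
  qed
  then show ?thesis using V finite_subset[OF V(1) \<open>finite ?V\<close>]
    by (intro exI[of _ V]) blast
qed

text \<open>The counting argument: \<open>V\<close> is a disjoint family of stopped words with at least a constant times
  \<open>x powr (- t)\<close> members, \<open>W\<close> completes them to loops, and \<open>V'\<close> is a class of words in
  \<open>V\<close> with the same first letter and the same ratio \<open>\<rho>\<close> of the completed loop, at least as large as
  the average class.\<close>
lemma exists_large_uniform_family:
  assumes fin: "finite (transformation_group M A T j)" and Q: "Q \<in> transformation_group M A T j"
    and s: "0 < s" "s < t" and t: "hausdorff_measure t (F_set M A S) \<noteq> 0"
  shows "\<exists>(V :: nat list set) W \<rho>. finite V \<and> V \<noteq> {} \<and>
      (\<forall>u\<in>V. W u \<in> loop_words M A j \<and> comp_word T (W u) = Q \<and> ratio (W u) = \<rho>) \<and>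
      disjoint_family_on (\<lambda>u. comp_word S (W u) ` trap) V \<and> 1 \<le> card V * \<rho> powr s"
proof -
  obtain p q L where comp: "\<And>u. u \<noteq> [] \<Longrightarrow> set u \<subseteq> {..<M} \<Longrightarrow> successively (transition A) u \<Longrightarrow>
      p (hd u) @ u @ q u \<in> loop_words M A j \<and> comp_word T (p (hd u) @ u @ q u) = Q \<and>
      length (p (hd u)) + length (q u) \<le> L"
    using loop_completion[OF fin Q] by blast
  have "0 < t" using s by simp
  with t obtain c \<delta> where c: "0 < c" "0 < \<delta>" and card_ge:
    "\<And>(V :: nat list set) C d. finite V \<Longrightarrow> F_set M A S \<subseteq> (\<Union>u\<in>V. C u) \<Longrightarrow> (\<And>u. u \<in> V \<Longrightarrow> bounded (C u)) \<Longrightarrow>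
       (\<And>u. u \<in> V \<Longrightarrow> diameter (C u) \<le> d) \<Longrightarrow> 0 \<le> d \<Longrightarrow> d \<le> \<delta> \<Longrightarrow> c \<le> card V * d powr t"
    using finite_cover_card_ge[where 'i = "nat list"] by metis
  define \<theta> where "\<theta> = max_ratio powr (t - s)"
  define b where "b = (6 * radius) powr t"
  define a where "a = (min_ratio ^ (L + 1)) powr s"
  have M: "0 < M" using j_less by simp
  have pos: "0 < a" "0 < b" using min_ratio_pos radius_pos by (auto simp: a_def b_def)
  have \<theta>: "0 < \<theta>" "\<theta> < 1"
    using max_ratio_pos max_ratio_less_1 s powr_less_mono2[of "t - s" max_ratio 1] by (auto simp: \<theta>_def)
  \<comment> \<open>The bound is what the final estimate needs: there \<open>c\<close> comes from the covers, \<open>b\<close> from the size of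
    the enlarged cylinders and \<open>a\<close> from the loss of ratio in completing words to loops.\<close>
  have "\<forall>\<^sub>F k in sequentially. real (k + (L + 1)) ^ M * \<theta> ^ k < c * a / (M * b)"
    by (rule order_tendstoD(2)[OF polynomial_times_geometric_tendsto_0[OF \<theta> M]]) (use c pos M in simp)
  moreover have "\<forall>\<^sub>F k in sequentially. 6 * radius * max_ratio ^ k < \<delta>"
    using tendsto_max_ratio_power c(2) by (rule order_tendstoD)
  moreover have "\<forall>\<^sub>F k in sequentially. 0 < k" by (rule eventually_gt_at_top)
  ultimately have "\<forall>\<^sub>F k in sequentially. real (k + (L + 1)) ^ M * \<theta> ^ k < c * a / (M * b) \<and>
      6 * radius * max_ratio ^ k < \<delta> \<and> 0 < k"
    by (intro eventually_conj)
  then obtain k where k: "real (k + (L + 1)) ^ M * \<theta> ^ k < c * a / (M * b)"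
    "6 * radius * max_ratio ^ k < \<delta>" "0 < k"
    by (auto simp: eventually_sequentially)
  define x where "x = max_ratio ^ k"
  have x: "0 < x" using max_ratio_pos by (simp add: x_def)
  obtain V where V: "finite V"
    "\<And>u. u \<in> V \<Longrightarrow> u \<noteq> [] \<and> set u \<subseteq> {..<M} \<and> successively (transition A) u \<and> length u \<le> k \<and>
       min_ratio * x \<le> ratio u"
    "disjoint_family_on (\<lambda>u. comp_word S u ` trap) V"
    "F_set M A S \<subseteq> (\<Union>u\<in>V. cball (comp_word S u 0) (3 * radius * x))"
    using disjoint_words_cover[OF k(3)] unfolding x_def by blast
  have V_large: "c \<le> card V * (6 * radius * x) powr t"
    using V(1,4) radius_pos x k(2) by (intro card_ge) (auto simp: diameter_cball x_def)
  define W where "W u = p (hd u) @ u @ q u" for u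
  have W: "W u \<in> loop_words M A j" "comp_word T (W u) = Q" "length (p (hd u)) + length (q u) \<le> L"
    if "u \<in> V" for u
    using comp[of u] V(2)[OF that] by (auto simp: W_def)
  let ?R = "ratio ` {w. set w \<subseteq> {..<M} \<and> length w \<le> k + L}"
  let ?B = "{..<M} \<times> ?R"
  have R: "finite ?R" "card ?R \<le> (k + L + 1) ^ M"
    using card_prod_list_image_le[of "{..<M}" r "k + L"] by auto
  have "\<exists>y\<in>?B. card ((\<lambda>u. (hd u, ratio (W u))) -` {y} \<inter> V) * card ?B \<ge> card V"
  proof (rule pigeonhole_card)
    show "(\<lambda>u. (hd u, ratio (W u))) \<in> V \<rightarrow> ?B"
    proof
      fix u assume u: "u \<in> V"
      have "length (W u) \<le> k + L" using W(3)[OF u] V(2)[OF u] by (simp add: W_def)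
      then have "ratio (W u) \<in> ?R" using loop_word_set[OF W(1)[OF u]] by blast
      moreover have "hd u < M" using V(2)[OF u] by (auto dest: hd_in_set)
      ultimately show "(hd u, ratio (W u)) \<in> ?B" by simp
    qed
    show "finite ?B" using R by simp
    have "1 \<in> ?R" by (rule image_eqI[of _ _ "[]"]) auto
    then show "?B \<noteq> {}" using M by auto
  qed (rule V(1))
  then obtain i0 \<rho> where y: "card V \<le> card ((\<lambda>u. (hd u, ratio (W u))) -` {(i0, \<rho>)} \<inter> V) * card ?B"
    by auto
  define V' where "V' = (\<lambda>u. (hd u, ratio (W u))) -` {(i0, \<rho>)} \<inter> V"
  have V': "finite V'" "\<And>u. u \<in> V' \<Longrightarrow> u \<in> V \<and> hd u = i0 \<and> ratio (W u) = \<rho>"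
    using V(1) by (auto simp: V'_def)
  have "card V \<le> card V' * (M * (k + L + 1) ^ M)"
    using y R(2) unfolding V'_def[symmetric] card_cartesian_product
    by (elim order_trans) (intro mult_mono, auto)
  then have V'_large: "real (card V) \<le> card V' * (M * real (k + (L + 1)) ^ M)"
    by (metis (mono_tags) add.assoc of_nat_le_iff of_nat_mult of_nat_power)
  have "0 < card V" using V_large c(1) by (intro Nat.gr0I) simp
  then have "card V' \<noteq> 0" using V'_large by (intro notI) simp
  then obtain u0 where u0: "u0 \<in> V'" by fastforce
  have \<rho>: "min_ratio ^ (L + 1) * x \<le> \<rho>"
  proof -
    have u0V: "u0 \<in> V" "ratio (W u0) = \<rho>" using V'(2)[OF u0] by auto
    have sets: "set (p (hd u0)) \<subseteq> {..<M}" "set u0 \<subseteq> {..<M}" "set (q u0) \<subseteq> {..<M}"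
      using loop_word_set[OF W(1)[OF u0V(1)]] by (auto simp: W_def)
    have "min_ratio ^ L \<le> min_ratio ^ (length (p (hd u0)) + length (q u0))"
      using W(3)[OF u0V(1)] min_ratio_pos min_ratio_less_1 by (intro power_decreasing) auto
    also have "\<dots> \<le> ratio (p (hd u0)) * ratio (q u0)"
      unfolding power_add using min_ratio_pos ratio_pos[OF sets(1)]
      by (intro mult_mono min_ratio_power_le_ratio sets) auto
    finally have "min_ratio ^ L * (min_ratio * x) \<le> (ratio (p (hd u0)) * ratio (q u0)) * ratio u0"
      using V(2)[OF u0V(1)] min_ratio_pos x ratio_pos[OF sets(1)] ratio_pos[OF sets(3)]
      by (intro mult_mono) auto
    then show ?thesis using u0V(2) by (simp add: W_def algebra_simps)
  qed
  have "1 \<le> card V' * \<rho> powr s"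
  proof -
    have "c \<le> card V' * (M * real (k + (L + 1)) ^ M) * (6 * radius * x) powr t"
      using V_large mult_right_mono[OF V'_large, of "(6 * radius * x) powr t"] by simp
    also have "(6 * radius * x) powr t = b * (x powr s * \<theta> ^ k)"
    proof -
      have "\<theta> ^ k = x powr (t - s)"
        using max_ratio_pos by (simp add: \<theta>_def x_def powr_power powr_powr powr_realpow[symmetric] mult.commute)
      then have "x powr t = x powr s * \<theta> ^ k" using x by (simp add: powr_add[symmetric])
      then show ?thesis using radius_pos x by (simp add: powr_mult b_def)
    qed
    also have "card V' * (M * real (k + (L + 1)) ^ M) * (b * (x powr s * \<theta> ^ k))
        = (real (card V') * real M * b * x powr s) * (real (k + (L + 1)) ^ M * \<theta> ^ k)"
      by (simp only: mult_ac)
    also have "\<dots> \<le> (real (card V') * real M * b * x powr s) * (c * a / (M * b))"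
      using k(1) pos by (intro mult_left_mono) auto
    also have "\<dots> = c * (card V' * (a * x powr s))" using M pos by simp
    finally have "1 \<le> card V' * (a * x powr s)" using c(1) by simp
    also have "a * x powr s = (min_ratio ^ (L + 1) * x) powr s"
      using min_ratio_pos x by (simp add: a_def powr_mult)
    also have "card V' * (min_ratio ^ (L + 1) * x) powr s \<le> card V' * \<rho> powr s"
      using \<rho> min_ratio_pos x s by (intro mult_left_mono powr_mono2) auto
    finally show ?thesis .
  qed
  moreover have "disjoint_family_on (\<lambda>u. comp_word S (W u) ` trap) V'"
    unfolding disjoint_family_on_def
  proof (intro ballI impI)
    fix u u' assume u: "u \<in> V'" "u' \<in> V'" "u \<noteq> u'"
    have piece: "comp_word S (W u) ` trap \<subseteq> comp_word S (p i0) ` comp_word S u ` trap" if "u \<in> V'" for u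
    proof -
      have eq: "comp_word S (W u) = comp_word S (p i0) \<circ> comp_word S u \<circ> comp_word S (q u)"
        using V'(2)[OF that] by (simp add: W_def comp_word_append comp_assoc)
      have "set (q u) \<subseteq> {..<M}"
        using loop_word_set[OF W(1)] V'(2)[OF that] by (auto simp: W_def)
      then have "comp_word S (q u) ` trap \<subseteq> trap" by (intro image_subsetI comp_word_trap)
      then show ?thesis unfolding eq image_comp[symmetric] by (intro image_mono)
    qed
    have "set (p i0) \<subseteq> {..<M}"
      using loop_word_set[OF W(1)] V'(2)[OF u(1)] by (auto simp: W_def)
    then have "inj (comp_word S (p i0))" by (rule inj_comp_word)
    moreover have "comp_word S u ` trap \<inter> comp_word S u' ` trap = {}"
      using V(3) V'(2) u unfolding disjoint_family_on_def by blast
    ultimately have "comp_word S (p i0) ` comp_word S u ` trap \<inter> comp_word S (p i0) ` comp_word S u' ` trap = {}"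
      by (simp add: image_Int[symmetric])
    then show "comp_word S (W u) ` trap \<inter> comp_word S (W u') ` trap = {}"
      using piece[OF u(1)] piece[OF u(2)] by blast
  qed
  moreover have "V' \<noteq> {}" using u0 by auto
  ultimately show ?thesis
    using V' W by (intro exI[of _ V'] exI[of _ W] exI[of _ \<rho>]) blast
qed

end

section \<open>Approximation from inside by separated self-similar sets\<close>

theorem corollary1p19:
  fixes M j :: nat and A :: "nat mat"
    and r :: "nat \<Rightarrow> real"
    and T :: "nat \<Rightarrow> real ^ 'd \<Rightarrow> real ^ 'd"
    and v :: "nat \<Rightarrow> real ^ 'd"
    and \<epsilon> :: real and Q :: "real ^ 'd \<Rightarrow> real ^ 'd"
  assumes "zero_one_matrix M A"
    and "irreducible_subshift M A"
    and "contracting_similarities {..<M} r T"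
    and "\<exists>i<M. \<exists>x \<in> F_part M A (sim r T v) i. \<exists>y \<in> F_part M A (sim r T v) i. x \<noteq> y"
    and "j < M"
    and "finite (transformation_group M A T j)"
    and "\<epsilon> > 0"
    and "Q \<in> transformation_group M A T j"
  shows "\<exists>(\<rho>::real) (m::nat) (r'::nat \<Rightarrow> real) (T'::nat \<Rightarrow> real ^ 'd \<Rightarrow> real ^ 'd)
            (v'::nat \<Rightarrow> real ^ 'd) (K::(real ^ 'd) set).
           0 < \<rho> \<and> \<rho> < 1 \<and>
           contracting_similarities {1..m} r' T' \<and>
           is_attractor {1..m} (sim r' T' v') K \<and>
           strong_separation {1..m} (sim r' T' v') K \<and>
           K \<subseteq> F_part M A (sim r T v) j \<and>
           F_part M A (sim r T v) j \<subseteq> F_set M A (sim r T v) \<and>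
           hausdorff_dim (F_set M A (sim r T v)) - ereal \<epsilon> < hausdorff_dim K \<and>
           (\<forall>i\<in>{1..m}. T' i = Q \<and> r' i = \<rho>)"
proof -
  interpret irreducible_system M r T v A j
    by unfold_locales (use assms in auto)
  let ?F = "F_set M A S"
  have "\<bar>hausdorff_dim ?F\<bar> \<noteq> \<infinity>"
    using hausdorff_dim_subset_limit_set_finite[OF F_set_subset_limit_set] hausdorff_dim_nonneg[of ?F]
    by auto
  then obtain D where D: "hausdorff_dim ?F = ereal D" by auto
  have "\<exists>(V :: nat list set) W \<rho> s. finite V \<and> V \<noteq> {} \<and>
      (\<forall>u\<in>V. W u \<in> loop_words M A j \<and> comp_word T (W u) = Q \<and> ratio (W u) = \<rho>) \<and>
      disjoint_family_on (\<lambda>u. comp_word S (W u) ` trap) V \<and> 1 \<le> card V * \<rho> powr s \<and> D - \<epsilon> < s"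
  proof (cases "D < \<epsilon>")
    case True
    obtain u where "u \<in> loop_words M A j" using loop_words_nonempty by auto
    then obtain w where "w \<in> loop_words M A j" "comp_word T (u @ w) = Q"
      using transformation_group_solve[OF assms(6) _ assms(8)] by (metis comp_word_append image_eqI)
    then have w: "u @ w \<in> loop_words M A j" "comp_word T (u @ w) = Q"
      using loop_words_append \<open>u \<in> loop_words M A j\<close> by auto
    then show ?thesis
      using True loop_word_ratio[OF w(1)]
      by (intro exI[of _ "{u @ w}"] exI[of _ id] exI[of _ "ratio (u @ w)"] exI[of _ 0])
        (auto simp: disjoint_family_on_def)
  next
    case False
    have "hausdorff_measure (D - \<epsilon> / 3) ?F \<noteq> 0"
    proof
      assume "hausdorff_measure (D - \<epsilon> / 3) ?F = 0"
      then have "hausdorff_dim ?F \<le> ereal (D - \<epsilon> / 3)"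
        unfolding hausdorff_dim_def using False \<open>\<epsilon> > 0\<close> by (intro Inf_lower) auto
      then show False using D \<open>\<epsilon> > 0\<close> by simp
    qed
    from exists_large_uniform_family[OF assms(6,8) _ _ this, of "D - \<epsilon> / 2"]
    obtain V :: "nat list set" and W \<rho> where "finite V" "V \<noteq> {}"
      "\<forall>u\<in>V. W u \<in> loop_words M A j \<and> comp_word T (W u) = Q \<and> ratio (W u) = \<rho>"
      "disjoint_family_on (\<lambda>u. comp_word S (W u) ` trap) V" "1 \<le> card V * \<rho> powr (D - \<epsilon> / 2)"
      using False \<open>\<epsilon> > 0\<close> by auto
    then show ?thesis using \<open>\<epsilon> > 0\<close>
      by (intro exI[of _ V] exI[of _ W] exI[of _ \<rho>] exI[of _ "D - \<epsilon> / 2"]) auto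
  qed
  then obtain V :: "nat list set" and W \<rho> s where V: "finite V" "V \<noteq> {}"
    "\<And>u. u \<in> V \<Longrightarrow> W u \<in> loop_words M A j" "\<And>u. u \<in> V \<Longrightarrow> comp_word T (W u) = Q"
    "\<And>u. u \<in> V \<Longrightarrow> ratio (W u) = \<rho>"
    "disjoint_family_on (\<lambda>u. comp_word S (W u) ` trap) V" "1 \<le> card V * \<rho> powr s" and s: "D - \<epsilon> < s"
    by (elim exE conjE) (rule that, blast+)
  obtain m r' T' v' K where K: "0 < \<rho>" "\<rho> < 1" "contracting_similarities {1..m::nat} r' T'"
    "is_attractor {1..m} (sim r' T' v') K" "strong_separation {1..m} (sim r' T' v') K"
    "K \<subseteq> F_part M A S j" "ereal s \<le> hausdorff_dim K" "\<forall>i\<in>{1..m}. T' i = Q \<and> r' i = \<rho>"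
    using uniform_subsystem[OF V] by blast
  have "hausdorff_dim ?F - ereal \<epsilon> < ereal s" using D s by simp
  then have "hausdorff_dim ?F - ereal \<epsilon> < hausdorff_dim K" using K(7) by (rule order.strict_trans2)
  then show ?thesis
    using K F_part_subset_F_set
    by (intro exI[of _ \<rho>] exI[of _ m] exI[of _ r'] exI[of _ T'] exI[of _ v'] exI[of _ K] conjI)
qed

end
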